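(* Let $P_{X,Y}$ be a joint probability distribution on $\mathcal X\times\mathcal Y$ (finite sets) and let $|\psi\rangle\in\mathcal H_A\otimes\mathcal H_B$ be a regular embedding of $P_{X,Y}$. If $|\psi\rangle$ is weakly self-composable, then $|\psi\rangle$ is a trivial embedding of $P_{X,Y}$, i.e. $S(X\searrow Y\,|\,B)=0$ or $S(Y\searrow X\,|\,A)=0$.
   Context: **Dependent part.** For random variables $X,Y$, put $f_X(x):=P_{Y|X=x}$ and $X\searrow Y:=f_X(X)$. $Y\searrow X$ is defined symmetrically. **Regular embeddings.** A regular embedding of $P_{X,Y}$ is a pure state $|\psi\rangle\in\mathcal H_A\otimes\mathcal H_B$ (finite-dimensional, Alice holding $A$ and Bob holding $B$, no auxiliary registers) such that measuring $A$ and $B$ in their computational bases $\{|x\rangle\}_{x\in\mathcal X}$, $\{|y\rangle\}_{y\in\mathcal Y}$ yields $(X,Y)$ distributed according to $P_{X,Y}$. These measurements are the honest behavior of Alice and Bob. **Triviality.** $S(U|V)=S(UV)-S(V)$ is conditional von Neumann entropy. $S(X\searrow Y|B)$ is computed on the state obtained when $A$ is measured in the computational basis to give $X$, from which $X\searrow Y$ is computed, while $B$ is left unmeasured; $S(Y\searrow X|A)$ symmetrically. The regular embedding is *trivial* if $S(Y\searrow X|A)=0$ or $S(X\searrow Y|B)=0$, and *non-trivial* otherwise. **Ideal functionality.** An ideal functionality $\mathsf{ID}_\psi$ for $|\psi\rangle$ is a classical interface to one copy of $|\psi\rangle$. Each party submits an element of $[0,1]$. Each $s\in[0,1]$ encodes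 a measurement (POVM) acting locally on the submitting party's share ($\mathcal H_A$ for Alice, $\mathcal H_B$ for Bob) of that single copy; this measurement is applied and the classical outcome is returned immediately to the submitting party, irrespective of whether the other party has submitted anything. Input $0$ encodes the honest computational-basis measurement. A party may query repeatedly, each new measurement being applied to the residual state. The encoding of measurements by $[0,1]$ is arbitrary; in particular all possible local POVMs may be available. **Weak self-composability.** An attack by dishonest Bob against $|\psi\rangle^{\otimes m}$ is a POVM, possibly acting jointly (coherently), on $\mathcal H_B^{\otimes m}$, while Alice honestly measures to obtain $X_1,\dots,X_m$; attacks by dishonest Alice are defined symmetrically. An attack is *simulated* by calls to $m$ copies of $\mathsf{ID}_\psi$ if the adversary, interacting only with $m$ independent ideal functionalities $\mathsf{ID}_\psi$ (one per copy of $|\psi\rangle$), with queries to each chosen possibly adaptively depending on previously received classical outcomes, and using classical post-processing, can produce a classical value having the same joint distribution with the honest party's outputs as the outcome of the attack. The embedding $|\psi\rangle$ is *weakly self-composable* if there exists an ideal functionality $\mathsf{ID}_\psi$ such that for every $m>0$ all attacks against $|\psi\rangle^{\otimes m}$ can be simulated by appropriate calls to $m$ copies of $\mathsf{ID}_\psi$. *)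

theory Defs
  imports
    "HOL-Probability.Probability_Mass_Function"
    "Jordan_Normal_Form.Spectral_Radius"
begin

text \<open>
  An operator on the Hilbert space with orthonormal basis \<open>I\<close> (a finite set) is given by its matrix
  entries \<open>M i j\<close> for \<open>i, j \<in> I\<close>; entries outside \<open>I\<close> are irrelevant.
\<close>

type_synonym 'i operator = "'i \<Rightarrow> 'i \<Rightarrow> complex"


section \<open>Entropy\<close>

text \<open>The matrix is taken with respect to some enumeration of the index set; the spectrum and the
  multiplicities do not depend on it.\<close>

definition matrix_of :: "'i set \<Rightarrow> 'i operator \<Rightarrow> complex mat" where
  "matrix_of I M =
     mat (card I) (card I) (\<lambda>(a, b). M (from_nat_into I a) (from_nat_into I b))"

text \<open>The sum runs over the distinct eigenvalues, weighted by their multiplicity. The eigenvalue \<open>0\<close>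
  contributes \<open>0\<close>.\<close>

definition von_neumann_entropy :: "'i set \<Rightarrow> 'i operator \<Rightarrow> real" where
  "von_neumann_entropy I \<rho> =
     - (\<Sum>l\<in>spectrum (matrix_of I \<rho>).
          real (order l (char_poly (matrix_of I \<rho>))) * (Re l * log 2 (Re l)))"

definition partial_trace_fst :: "'u set \<Rightarrow> ('u \<times> 'v) operator \<Rightarrow> 'v operator" where
  "partial_trace_fst U \<rho> = (\<lambda>v v'. \<Sum>u\<in>U. \<rho> (u, v) (u, v'))"

definition conditional_entropy :: "'u set \<Rightarrow> 'v set \<Rightarrow> ('u \<times> 'v) operator \<Rightarrow> real" where
  "conditional_entropy U V \<rho> =
     von_neumann_entropy (U \<times> V) \<rho> - von_neumann_entropy V (partial_trace_fst U \<rho>)"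


section \<open>Regular embeddings and triviality\<close>

text \<open>
  \<open>\<psi> x y\<close> is the amplitude of the basis vector \<open>x \<otimes> y\<close>. That \<open>\<psi>\<close> is a unit vector follows from the
  condition, since the probabilities sum to \<open>1\<close>.
\<close>

definition regular_embedding ::
    "('x::finite \<times> 'y::finite) pmf \<Rightarrow> ('x \<Rightarrow> 'y \<Rightarrow> complex) \<Rightarrow> bool" where
  "regular_embedding P \<psi> \<longleftrightarrow> (\<forall>x y. (cmod (\<psi> x y))\<^sup>2 = pmf P (x, y))"

text \<open>\<open>swap_parties\<close> exchanges the roles of Alice and Bob; every notion below is defined for one of the
  two parties and obtained for the other one by swapping.\<close>

definition swap_parties :: "('x \<Rightarrow> 'y \<Rightarrow> complex) \<Rightarrow> 'y \<Rightarrow> 'x \<Rightarrow> complex" where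
  "swap_parties \<psi> = (\<lambda>y x. \<psi> x y)"

text \<open>The function \<open>f\<^sub>X\<close>, mapping \<open>x\<close> to the conditional distribution of \<open>Y\<close> given \<open>X = x\<close>; it is
  unspecified for values \<open>x\<close> of probability \<open>0\<close>.\<close>

definition dependent_part :: "('x \<times> 'y) pmf \<Rightarrow> 'x \<Rightarrow> 'y pmf" where
  "dependent_part P x = map_pmf snd (cond_pmf P {z. fst z = x})"

definition dependent_alphabet :: "('x \<times> 'y) pmf \<Rightarrow> 'y pmf set" where
  "dependent_alphabet P = dependent_part P ` set_pmf (map_pmf fst P)"

text \<open>
  The joint state of the classical register holding \<open>f\<^sub>X(X)\<close> and the unmeasured system \<open>B\<close>, after
  measuring \<open>A\<close> in the computational basis. Values \<open>x\<close> of probability \<open>0\<close> contribute nothing, since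
  for them the amplitudes \<open>\<psi> x y\<close> vanish.
\<close>

definition dependent_state ::
    "('x::finite \<times> 'y) pmf \<Rightarrow> ('x \<Rightarrow> 'y \<Rightarrow> complex) \<Rightarrow> ('y pmf \<times> 'y) operator" where
  "dependent_state P \<psi> = (\<lambda>(c, y) (c', y').
     if c = c' then \<Sum>x | dependent_part P x = c. \<psi> x y * cnj (\<psi> x y') else 0)"

definition dependent_entropy ::
    "('x::finite \<times> 'y::finite) pmf \<Rightarrow> ('x \<Rightarrow> 'y \<Rightarrow> complex) \<Rightarrow> real" where
  "dependent_entropy P \<psi> =
     conditional_entropy (dependent_alphabet P) UNIV (dependent_state P \<psi>)"

text \<open>The first disjunct is \<open>S(X \<searrow> Y | B) = 0\<close>, the second one is \<open>S(Y \<searrow> X | A) = 0\<close>.\<close>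

definition trivial_embedding ::
    "('x::finite \<times> 'y::finite) pmf \<Rightarrow> ('x \<Rightarrow> 'y \<Rightarrow> complex) \<Rightarrow> bool" where
  "trivial_embedding P \<psi> \<longleftrightarrow>
     dependent_entropy P \<psi> = 0 \<or>
     dependent_entropy (map_pmf prod.swap P) (swap_parties \<psi>) = 0"


section \<open>Ideal functionalities\<close>

text \<open>
  A measurement together with its effect on the state is a finite set of Kraus operators, each labelled
  with the classical outcome it reports. Several Kraus operators may carry the same label: the element
  of the POVM for outcome \<open>j\<close> is the sum of \<open>K\<^sup>* K\<close> over the operators \<open>K\<close> labelled \<open>j\<close>, so
  that every quantum instrument with finitely many outcomes is covered.
\<close>

type_synonym 'b instrument = "(nat \<times> 'b operator) set"

definition is_instrument :: "'b::finite instrument \<Rightarrow> bool" where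
  "is_instrument M \<longleftrightarrow> finite M \<and>
     (\<forall>b b'. (\<Sum>(j, K)\<in>M. \<Sum>a\<in>UNIV. cnj (K a b) * K a b') = (if b = b' then 1 else 0))"

definition basis_projection :: "'b \<Rightarrow> 'b operator" where
  "basis_projection y = (\<lambda>a b. if a = y \<and> b = y then 1 else 0)"

text \<open>Outcome labels are natural numbers; the basis element \<open>y\<close> is reported as \<open>to_nat y\<close>.\<close>

definition computational_measurement :: "'b::finite instrument" where
  "computational_measurement = {(to_nat y, basis_projection y) | y. True}"

text \<open>One party's side of the interface; only inputs in \<open>[0,1]\<close> matter.\<close>

definition is_interface :: "(real \<Rightarrow> 'b::finite instrument) \<Rightarrow> bool" where
  "is_interface F \<longleftrightarrow>
     (\<forall>s\<in>{0..1}. is_instrument (F s)) \<and> F 0 = computational_measurement"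


section \<open>Attacks and their simulation\<close>

text \<open>
  Basis elements of an \<open>m\<close>-fold tensor power are lists of length \<open>m\<close>. The adversary holds the second
  system, called \<open>B\<close>; the honest party measures the first one in the computational basis.
\<close>

definition tuples :: "nat \<Rightarrow> 'b list set" where
  "tuples m = {ys. length ys = m}"

definition tensor_power ::
    "nat \<Rightarrow> ('x \<Rightarrow> 'y \<Rightarrow> complex) \<Rightarrow> 'x list \<Rightarrow> 'y list \<Rightarrow> complex" where
  "tensor_power m \<psi> = (\<lambda>xs ys. \<Prod>i<m. \<psi> (xs ! i) (ys ! i))"

definition positive_semidefinite :: "'i set \<Rightarrow> 'i operator \<Rightarrow> bool" where
  "positive_semidefinite I E \<longleftrightarrow>
     (\<forall>v. let q = (\<Sum>i\<in>I. \<Sum>j\<in>I. cnj (v i) * E i j * v j) in Im q = 0 \<and> 0 \<le> Re q)"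

text \<open>A POVM with outcomes \<open>0, \<dots>, r - 1\<close>.\<close>

definition is_povm :: "'i set \<Rightarrow> nat \<Rightarrow> (nat \<Rightarrow> 'i operator) \<Rightarrow> bool" where
  "is_povm I r E \<longleftrightarrow>
     (\<forall>k<r. positive_semidefinite I (E k)) \<and>
     (\<forall>i\<in>I. \<forall>j\<in>I. (\<Sum>k<r. E k i j) = (if i = j then 1 else 0))"

text \<open>Probability that the honest party obtains \<open>xs\<close> and the adversary's POVM yields \<open>k\<close>.\<close>

definition attack_prob ::
    "nat \<Rightarrow> ('x \<Rightarrow> 'y::finite \<Rightarrow> complex) \<Rightarrow> nat \<Rightarrow> (nat \<Rightarrow> 'y list operator) \<Rightarrow>
     'x list \<Rightarrow> nat \<Rightarrow> real" where
  "attack_prob m \<psi> r E xs k =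
     (if k < r
      then Re (\<Sum>ys\<in>tuples m. \<Sum>ys'\<in>tuples m.
             cnj (tensor_power m \<psi> xs ys) * E k ys ys' * tensor_power m \<psi> xs ys')
      else 0)"

text \<open>
  A simulator either submits input \<open>s\<close> to copy \<open>i\<close> (\<open>Query i s\<close>) or stops with a final value. Its next
  action is chosen at random, depending on the transcript of all queries and answers so far. The number
  of queries is not bounded in advance.
\<close>

datatype action = Query nat real | Final nat

type_synonym transcript = "(nat \<times> real \<times> nat) list"

type_synonym simulator = "transcript \<Rightarrow> action pmf"

definition is_simulator :: "nat \<Rightarrow> simulator \<Rightarrow> bool" where
  "is_simulator m \<sigma> \<longleftrightarrow>
     (\<forall>h i s. Query i s \<in> set_pmf (\<sigma> h) \<longrightarrow> i < m \<and> s \<in> {0..1})"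

definition apply_at ::
    "nat \<Rightarrow> 'y::finite operator \<Rightarrow> ('x list \<Rightarrow> 'y list \<Rightarrow> complex) \<Rightarrow>
     'x list \<Rightarrow> 'y list \<Rightarrow> complex" where
  "apply_at i K w = (\<lambda>xs ys. \<Sum>b\<in>UNIV. K (ys ! i) b * w xs (ys[i := b]))"

text \<open>
  \<open>sim_prob m F \<sigma> n h w xs k\<close>: starting with transcript \<open>h\<close> and the subnormalised joint state \<open>w\<close> of
  all copies, the probability that the simulator stops with value \<open>k\<close> within \<open>n\<close> actions and the honest
  party obtains \<open>xs\<close>. The honest measurement acts on the other subsystem, hence commutes with all
  queries and may be evaluated last.
\<close>

primrec sim_prob ::
    "nat \<Rightarrow> (real \<Rightarrow> 'y::finite instrument) \<Rightarrow> simulator \<Rightarrow> nat \<Rightarrow> transcript \<Rightarrow>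
     ('x list \<Rightarrow> 'y list \<Rightarrow> complex) \<Rightarrow> 'x list \<Rightarrow> nat \<Rightarrow> real" where
  "sim_prob m F \<sigma> 0 h w xs k = 0"
| "sim_prob m F \<sigma> (Suc n) h w xs k =
     measure_pmf.expectation (\<sigma> h) (\<lambda>act. case act of
         Final k' \<Rightarrow> if k' = k then \<Sum>ys\<in>tuples m. (cmod (w xs ys))\<^sup>2 else 0
       | Query i s \<Rightarrow> \<Sum>(j, K)\<in>F s. sim_prob m F \<sigma> n (h @ [(i, s, j)]) (apply_at i K w) xs k)"

text \<open>The limit is the probability of eventually stopping with value \<open>k\<close>. As the attack's
  probabilities sum to \<open>1\<close>, a successful simulator stops with probability \<open>1\<close>.\<close>

definition simulates ::
    "nat \<Rightarrow> ('x \<Rightarrow> 'y::finite \<Rightarrow> complex) \<Rightarrow> (real \<Rightarrow> 'y instrument) \<Rightarrow> simulator \<Rightarrow>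
     nat \<Rightarrow> (nat \<Rightarrow> 'y list operator) \<Rightarrow> bool" where
  "simulates m \<psi> F \<sigma> r E \<longleftrightarrow>
     (\<forall>xs\<in>tuples m. \<forall>k.
        (\<lambda>n. sim_prob m F \<sigma> n [] (tensor_power m \<psi>) xs k) \<longlonglongrightarrow> attack_prob m \<psi> r E xs k)"

definition all_attacks_simulated ::
    "nat \<Rightarrow> ('x \<Rightarrow> 'y::finite \<Rightarrow> complex) \<Rightarrow> (real \<Rightarrow> 'y instrument) \<Rightarrow> bool" where
  "all_attacks_simulated m \<psi> F \<longleftrightarrow>
     (\<forall>r E. is_povm (tuples m) r E \<longrightarrow> (\<exists>\<sigma>. is_simulator m \<sigma> \<and> simulates m \<psi> F \<sigma> r E))"

text \<open>An ideal functionality consists of Alice's interface \<open>FA\<close> and Bob's interface \<open>FB\<close>.\<close>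

definition weakly_self_composable :: "('x::finite \<Rightarrow> 'y::finite \<Rightarrow> complex) \<Rightarrow> bool" where
  "weakly_self_composable \<psi> \<longleftrightarrow>
     (\<exists>FA FB. is_interface FA \<and> is_interface FB \<and>
        (\<forall>m>0. all_attacks_simulated m \<psi> FB \<and>
               all_attacks_simulated m (swap_parties \<psi>) FA))"

end

theory Submission
  imports Defs
begin

text \<open>
  If Bob's conditional states \<open>\<psi> x\<close> belonging to different values of the dependent part were always
  orthogonal, then \<open>S(X \<searrow> Y | B)\<close> would vanish. So a non-trivial embedding has two letters
  \<open>x\<close>, \<open>x'\<close> whose conditional states are neither orthogonal nor parallel. For such a pair and
  \<open>m\<close> large enough, the Pusey--Barrett--Rudolph measurement on \<open>m\<close> copies is a coherent attack
  each of whose outcomes is impossible for some string in \<open>{x, x'}\<^sup>m\<close>. A simulator queries the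
  copies one by one, so on every branch the joint state remains a product state; and a measurement
  preserves, summed over its outcomes, the inner product of Bob's states for \<open>x\<dots>x\<close> and
  \<open>x'\<dots>x'\<close>, which is initially nonzero. As the simulator stops with
  probability \<open>1\<close>, it stops on some branch where this inner product is nonzero. There no factor has been annihilated, so the reported value is
  possible for all strings in \<open>{x, x'}\<^sup>m\<close>, contrary to the exclusion property.
\<close>

section \<open>Entropy\<close>

text \<open>Both sides come from one block matrix \<open>M\<close>. Clearing its block
  \<open>B'\<close> by column operations turns the determinant into
  \<open>char_poly (A * B)\<close>; clearing it by row operations, after scaling the lower rows by
  \<open>X\<close>, yields \<open>char_poly (B * A)\<close> and the two powers of
  \<open>X\<close>.\<close>

lemma char_poly_mult_swap:
  fixes A B :: "'a :: idom mat"
  assumes A: "A \<in> carrier_mat n m" and B: "B \<in> carrier_mat m n"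
  shows "[:0, 1:] ^ m * char_poly (A * B) = [:0, 1:] ^ n * char_poly (B * A)"
proof -
  interpret c: comm_ring_hom "\<lambda>a::'a. [:a:]"
    by unfold_locales (auto simp: one_pCons)
  define A' where "A' = map_mat (\<lambda>a. [:a:]) A"
  define B' where "B' = map_mat (\<lambda>a. [:a:]) B"
  let ?X = "[:0, 1:] :: 'a poly"
  have A': "A' \<in> carrier_mat n m" and B': "B' \<in> carrier_mat m n"
    using A B by (auto simp: A'_def B'_def)
  have AB: "char_poly_matrix (A * B) = ?X \<cdot>\<^sub>m 1\<^sub>m n + - (A' * B')"
    using A B unfolding char_poly_matrix_def A'_def B'_def c.mat_hom_mult[OF A B, symmetric]
    by (intro eq_matI) auto
  have BA: "char_poly_matrix (B * A) = ?X \<cdot>\<^sub>m 1\<^sub>m m + - (B' * A')"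
    using A B unfolding char_poly_matrix_def A'_def B'_def c.mat_hom_mult[OF B A, symmetric]
    by (intro eq_matI) auto
  define M where "M = four_block_mat (?X \<cdot>\<^sub>m 1\<^sub>m n) A' B' (1\<^sub>m m)"
  have M: "M \<in> carrier_mat (n + m) (n + m)"
    using A' B' by (auto simp: M_def)
  let ?L = "four_block_mat (1\<^sub>m n) (0\<^sub>m n m) (- B') (1\<^sub>m m)"
  have "M * ?L = four_block_mat (?X \<cdot>\<^sub>m 1\<^sub>m n * 1\<^sub>m n + A' * - B') (?X \<cdot>\<^sub>m 1\<^sub>m n * 0\<^sub>m n m + A' * 1\<^sub>m m)
      (B' * 1\<^sub>m n + 1\<^sub>m m * - B') (B' * 0\<^sub>m n m + 1\<^sub>m m * 1\<^sub>m m)"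
    unfolding M_def using A' B' by (intro mult_four_block_mat) auto
  also have "\<dots> = four_block_mat (char_poly_matrix (A * B)) A' (0\<^sub>m m n) (1\<^sub>m m)"
    using A' B' by (intro cong_four_block_mat) (auto simp: AB)
  finally have "det (M * ?L) = det (char_poly_matrix (A * B)) * det (1\<^sub>m m :: 'a poly mat)"
    using A B A' det_four_block_mat_lower_left_zero[of "char_poly_matrix (A * B)" n A' m "0\<^sub>m m n" "1\<^sub>m m"]
    by simp
  moreover have "det ?L = 1"
    using B' det_four_block_mat_upper_right_zero[of "1\<^sub>m n" n "0\<^sub>m n m" m "- B'" "1\<^sub>m m"]
    by simp
  ultimately have 1: "det M = char_poly (A * B)"
    using det_mult[OF M, of ?L] B' by (simp add: char_poly_def)
  let ?R = "four_block_mat (1\<^sub>m n) (0\<^sub>m n m) (- B') (?X \<cdot>\<^sub>m 1\<^sub>m m)"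
  have "?R * M = four_block_mat (1\<^sub>m n * (?X \<cdot>\<^sub>m 1\<^sub>m n) + 0\<^sub>m n m * B') (1\<^sub>m n * A' + 0\<^sub>m n m * 1\<^sub>m m)
      (- B' * (?X \<cdot>\<^sub>m 1\<^sub>m n) + ?X \<cdot>\<^sub>m 1\<^sub>m m * B') (- B' * A' + ?X \<cdot>\<^sub>m 1\<^sub>m m * 1\<^sub>m m)"
    unfolding M_def using A' B' by (intro mult_four_block_mat) auto
  also have "\<dots> = four_block_mat (?X \<cdot>\<^sub>m 1\<^sub>m n) A' (0\<^sub>m m n) (char_poly_matrix (B * A))"
  proof (intro cong_four_block_mat)
    show "- B' * (?X \<cdot>\<^sub>m 1\<^sub>m n) + ?X \<cdot>\<^sub>m 1\<^sub>m m * B' = 0\<^sub>m m n"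
      using B' by (simp add: mult_smult_distrib[of _ m n _ n] mult_smult_assoc_mat[of _ m m _ n])
        (auto intro!: eq_matI)
    show "- B' * A' + ?X \<cdot>\<^sub>m 1\<^sub>m m * 1\<^sub>m m = char_poly_matrix (B * A)"
      using A' B' by (auto simp: BA intro!: eq_matI)
  qed (use A' B' in auto)
  finally have "det (?R * M) = det (?X \<cdot>\<^sub>m 1\<^sub>m n) * char_poly (B * A)"
    using A B A' det_four_block_mat_lower_left_zero[of "?X \<cdot>\<^sub>m 1\<^sub>m n" n A' m "0\<^sub>m m n" "char_poly_matrix (B * A)"]
    by (simp add: char_poly_def)
  moreover have "det ?R = ?X ^ m"
    using B' det_four_block_mat_upper_right_zero[of "1\<^sub>m n" n "0\<^sub>m n m" m "- B'" "?X \<cdot>\<^sub>m 1\<^sub>m m"]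
    by simp
  ultimately have "?X ^ m * det M = ?X ^ n * char_poly (B * A)"
    using det_mult[of ?R "n + m" M] M B' by simp
  then show ?thesis
    by (simp add: 1)
qed

lemma spectrum_eq_roots_char_poly:
  fixes A :: "'a :: field mat"
  assumes "A \<in> carrier_mat n n"
  shows "spectrum A = {l. poly (char_poly A) l = 0}"
  using eigenvalue_root_char_poly[OF assms] by (auto simp: spectrum_def)

text \<open>Away from 0 the powers of \<open>X\<close> contribute no roots, so eigenvalues and
  multiplicities agree there. The eigenvalue 0, whose multiplicities may differ, has weight
  0.\<close>

lemma entropy_matrix_of_mult_swap:
  assumes A: "A \<in> carrier_mat (card I) (card J)" and B: "B \<in> carrier_mat (card J) (card I)"
    and I: "matrix_of I \<rho> = A * B" and J: "matrix_of J \<sigma> = B * A"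
  shows "von_neumann_entropy I \<rho> = von_neumann_entropy J \<sigma>"
proof -
  let ?X = "[:0, 1:] :: complex poly"
  let ?p = "char_poly (A * B)" and ?q = "char_poly (B * A)"
  let ?t = "\<lambda>p l. real (order l p) * (Re l * log 2 (Re l))"
  have AB: "A * B \<in> carrier_mat (card I) (card I)" and BA: "B * A \<in> carrier_mat (card J) (card J)"
    using A B by auto
  have eq: "?X ^ card J * ?p = ?X ^ card I * ?q"
    by (rule char_poly_mult_swap[OF A B])
  have nz: "?p \<noteq> 0" "?q \<noteq> 0"
    using degree_monic_char_poly[OF AB] degree_monic_char_poly[OF BA] by auto
  have roots: "{l. poly ?p l = 0 \<and> l \<noteq> 0} = {l. poly ?q l = 0 \<and> l \<noteq> 0}"
  proof (intro Collect_cong)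
    fix l :: complex
    have "l ^ card J * poly ?p l = l ^ card I * poly ?q l"
      using arg_cong[OF eq, of "\<lambda>p. poly p l"] by (simp add: poly_power)
    then show "poly ?p l = 0 \<and> l \<noteq> 0 \<longleftrightarrow> poly ?q l = 0 \<and> l \<noteq> 0"
      by (metis mult_eq_0_iff power_not_zero)
  qed
  have order: "order l ?p = order l ?q" if "l \<noteq> 0" for l
  proof -
    have "order l (?X ^ k * p) = order l p" if "p \<noteq> 0" for k and p :: "complex poly"
      using that \<open>l \<noteq> 0\<close> by (subst order_mult) (auto simp: order_0I poly_power)
    then show ?thesis
      using nz eq by metis
  qed
  have "(\<Sum>l\<in>spectrum (A * B). ?t ?p l) = (\<Sum>l | poly ?p l = 0 \<and> l \<noteq> 0. ?t ?p l)"
    unfolding spectrum_eq_roots_char_poly[OF AB] using nz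
    by (intro sum.mono_neutral_right) (auto simp: poly_roots_finite)
  also have "\<dots> = (\<Sum>l | poly ?q l = 0 \<and> l \<noteq> 0. ?t ?q l)"
    unfolding roots by (intro sum.cong) (auto simp: order)
  also have "\<dots> = (\<Sum>l\<in>spectrum (B * A). ?t ?q l)"
    unfolding spectrum_eq_roots_char_poly[OF BA] using nz
    by (intro sum.mono_neutral_left) (auto simp: poly_roots_finite)
  finally show ?thesis
    by (simp add: von_neumann_entropy_def I J)
qed

lemma matrix_of_mult:
  fixes V :: "'i \<Rightarrow> 'j \<Rightarrow> complex"
  assumes "finite J"
  shows "matrix_of I (\<lambda>i i'. \<Sum>j\<in>J. V i j * W j i') =
    mat (card I) (card J) (\<lambda>(a, b). V (from_nat_into I a) (from_nat_into J b)) *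
    mat (card J) (card I) (\<lambda>(a, b). W (from_nat_into J a) (from_nat_into I b))"
  (is "?L = ?R")
proof (intro eq_matI)
  have "(\<Sum>j\<in>J. g j) = (\<Sum>b<card J. g (from_nat_into J b))" for g :: "'j \<Rightarrow> complex"
    using bij_betw_from_nat_into_finite[OF assms] by (intro sum.reindex_bij_betw[symmetric])
  then show "?L $$ (a, b) = ?R $$ (a, b)"
    if "a < dim_row ?R" "b < dim_col ?R" for a b
    using that by (simp add: matrix_of_def scalar_prod_def atLeast0LessThan)
qed (auto simp: matrix_of_def)

text \<open>Trades a state for a Gram matrix: when \<open>W\<close> is the adjoint of
  \<open>V\<close>, the first operator is a mixture of the columns of \<open>V\<close> and the
  second holds their inner products.\<close>

lemma entropy_mult_swap:
  assumes "finite I" "finite J"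
  shows "von_neumann_entropy I (\<lambda>i i'. \<Sum>j\<in>J. V i j * W j i') =
    von_neumann_entropy J (\<lambda>j j'. \<Sum>i\<in>I. W j i * V i j')"
  by (rule entropy_matrix_of_mult_swap[OF _ _ matrix_of_mult[OF assms(2)] matrix_of_mult[OF assms(1)]])
    auto

lemma entropy_cong:
  assumes "finite I" "\<And>i j. i \<in> I \<Longrightarrow> j \<in> I \<Longrightarrow> \<rho> i j = \<sigma> i j"
  shows "von_neumann_entropy I \<rho> = von_neumann_entropy I \<sigma>"
proof -
  have "from_nat_into I a \<in> I" if "a < card I" for a
    using that by (intro from_nat_into) auto
  then have "matrix_of I \<rho> = matrix_of I \<sigma>"
    unfolding matrix_of_def by (intro cong_mat) (auto intro: assms(2))
  then show ?thesis
    by (simp add: von_neumann_entropy_def)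
qed

text \<open>Both states are of the form \<open>N N\<^sup>*\<close>, and under the orthogonality hypothesis the two
  matrices \<open>N\<^sup>* N\<close> are the Gram matrix of Bob's conditional states.\<close>

lemma dependent_entropy_eq_0:
  fixes P :: "('x::finite \<times> 'y::finite) pmf"
  assumes emb: "regular_embedding P \<psi>"
    and orth: "\<And>x x'. x \<in> set_pmf (map_pmf fst P) \<Longrightarrow> x' \<in> set_pmf (map_pmf fst P) \<Longrightarrow>
      dependent_part P x \<noteq> dependent_part P x' \<Longrightarrow> (\<Sum>y\<in>UNIV. cnj (\<psi> x y) * \<psi> x' y) = 0"
  shows "dependent_entropy P \<psi> = 0"
proof -
  let ?C = "dependent_alphabet P" and ?f = "dependent_part P"
  let ?G = "\<lambda>x x'. \<Sum>y\<in>UNIV. cnj (\<psi> x y) * \<psi> x' y"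
  \<comment> \<open>Column \<open>x\<close> of \<open>N\<close> is the register value
    \<open>?f x\<close> tensored with \<open>\<psi> x\<close>, so the dependent state is
    \<open>N\<close> times its adjoint.\<close>
  define N where "N = (\<lambda>(c, y) x. if ?f x = c then \<psi> x y else 0)"
  have C: "finite ?C"
    by (simp add: dependent_alphabet_def)
  \<comment> \<open>For \<open>x\<close> of probability 0, \<open>?f x\<close> is unspecified and
    might lie outside \<open>?C\<close>; the vanishing amplitudes make such \<open>x\<close>
    harmless.\<close>
  have zero: "\<psi> x y = 0" if "x \<notin> set_pmf (map_pmf fst P)" for x y
  proof -
    have "(x, y) \<notin> set_pmf P"
      using that by force
    then show ?thesis
      using emb by (auto simp: regular_embedding_def set_pmf_iff dest!: spec[of _ x] spec[of _ y])
  qed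
  have supp: "?f x \<in> ?C" if "\<psi> x y \<noteq> 0" for x y
  proof -
    have "x \<in> set_pmf (map_pmf fst P)"
      using that zero by blast
    then show ?thesis
      by (auto simp: dependent_alphabet_def)
  qed
  have "von_neumann_entropy (?C \<times> UNIV) (dependent_state P \<psi>) =
    von_neumann_entropy (?C \<times> UNIV) (\<lambda>i i'. \<Sum>x\<in>UNIV. N i x * cnj (N i' x))"
  proof (rule entropy_cong)
    fix i i' assume "i \<in> ?C \<times> (UNIV :: 'y set)" "i' \<in> ?C \<times> (UNIV :: 'y set)"
    obtain c y c' y' where [simp]: "i = (c, y)" "i' = (c', y')"
      by (cases i, cases i')
    have "(\<Sum>x | ?f x = c. \<psi> x y * cnj (\<psi> x y')) =
      (\<Sum>x\<in>UNIV. N (c, y) x * cnj (N (c, y') x))"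
      by (intro sum.mono_neutral_cong_left) (auto simp: N_def)
    then show "dependent_state P \<psi> i i' = (\<Sum>x\<in>UNIV. N i x * cnj (N i' x))"
      by (auto simp: dependent_state_def N_def intro!: sum.neutral[symmetric])
  qed (use C in auto)
  also have "\<dots> = von_neumann_entropy UNIV (\<lambda>x x'. \<Sum>i\<in>?C \<times> UNIV. cnj (N i x) * N i x')"
    using C by (intro entropy_mult_swap) auto
  also have "\<dots> = von_neumann_entropy UNIV ?G"
  proof (rule entropy_cong)
    fix x x'
    have "(\<Sum>i\<in>?C \<times> UNIV. cnj (N i x) * N i x') =
      (\<Sum>y\<in>UNIV. \<Sum>c\<in>?C. if c = ?f x then if ?f x = ?f x' then cnj (\<psi> x y) * \<psi> x' y else 0 else 0)"
      by (subst sum.swap) (auto simp: N_def sum.cartesian_product intro!: sum.cong)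
    also have "\<dots> = (if ?f x = ?f x' then ?G x x' else 0)"
      using C supp by (auto simp: sum.delta intro!: sum.cong)
    \<comment> \<open>The entries deleted by the register vanish anyway, by \<open>orth\<close> or
      because one of the vectors is zero.\<close>
    also have "\<dots> = ?G x x'"
    proof (cases "x \<in> set_pmf (map_pmf fst P) \<and> x' \<in> set_pmf (map_pmf fst P)")
      case True
      then show ?thesis
        using orth[of x x'] by auto
    next
      case False
      then have "?G x x' = 0"
        by (intro sum.neutral) (auto simp del: set_map_pmf dest: zero)
      then show ?thesis
        by simp
    qed
    finally show "(\<Sum>i\<in>?C \<times> UNIV. cnj (N i x) * N i x') = ?G x x'" .
  qed simp
  \<comment> \<open>Swapping back without the register turns the Gram matrix into Bob's reduced
    state, whose entropy \<open>conditional_entropy\<close> subtracts.\<close>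
  also have "\<dots> = von_neumann_entropy UNIV (\<lambda>y y'. \<Sum>x\<in>UNIV. \<psi> x y * cnj (\<psi> x y'))"
    by (intro entropy_mult_swap) auto
  also have "\<dots> = von_neumann_entropy UNIV (partial_trace_fst ?C (dependent_state P \<psi>))"
  proof (rule entropy_cong)
    fix y y'
    have "partial_trace_fst ?C (dependent_state P \<psi>) y y' =
      (\<Sum>c\<in>?C. \<Sum>x\<in>UNIV. if c = ?f x then \<psi> x y * cnj (\<psi> x y') else 0)"
    proof -
      have "(\<Sum>x | ?f x = c. \<psi> x y * cnj (\<psi> x y')) =
        (\<Sum>x\<in>UNIV. if c = ?f x then \<psi> x y * cnj (\<psi> x y') else 0)" for c
        by (intro sum.mono_neutral_cong_left) auto
      then show ?thesis
        by (simp add: partial_trace_fst_def dependent_state_def)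
    qed
    also have "\<dots> = (\<Sum>x\<in>UNIV. \<psi> x y * cnj (\<psi> x y'))"
      using C supp by (subst sum.swap) (auto simp: sum.delta intro!: sum.cong)
    finally show "(\<Sum>x\<in>UNIV. \<psi> x y * cnj (\<psi> x y')) =
      partial_trace_fst ?C (dependent_state P \<psi>) y y'" by simp
  qed simp
  finally show ?thesis
    by (simp add: dependent_entropy_def conditional_entropy_def)
qed

section \<open>Parallel conditional states\<close>

lemma pmf_dependent_part:
  fixes P :: "('x \<times> 'y) pmf"
  assumes "x \<in> set_pmf (map_pmf fst P)"
  shows "pmf (dependent_part P x) y = pmf P (x, y) / measure_pmf.prob P {z. fst z = x}"
proof -
  have ne: "set_pmf P \<inter> {z. fst z = x} \<noteq> {}"
    using assms by auto
  have "pmf (dependent_part P x) y = measure_pmf.prob (cond_pmf P {z. fst z = x}) (snd -` {y})"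
    by (simp add: dependent_part_def pmf_map)
  also have "\<dots> = measure_pmf.prob (cond_pmf P {z. fst z = x}) {(x, y)}"
    using pmf_cond[OF ne] by (intro measure_prob_cong_0) auto
  also have "\<dots> = pmf P (x, y) / measure_pmf.prob P {z. fst z = x}"
    by (simp add: measure_pmf_single pmf_cond[OF ne])
  finally show ?thesis .
qed

text \<open>Scaling the amplitudes scales the probabilities by a constant, which normalisation
  removes. Contrapositively, distinct dependent parts force conditional states that are not
  parallel.\<close>

lemma dependent_part_eq_if_parallel:
  fixes P :: "('x::finite \<times> 'y::finite) pmf"
  assumes emb: "regular_embedding P \<psi>" and par: "\<And>y. \<psi> x y = c * \<psi> x' y"
    and x: "x \<in> set_pmf (map_pmf fst P)" and x': "x' \<in> set_pmf (map_pmf fst P)"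
  shows "dependent_part P x = dependent_part P x'"
proof -
  let ?p = "\<lambda>x. measure_pmf.prob P {z. fst z = x}"
  define s where "s = (cmod c)\<^sup>2 * ?p x' / ?p x"
  have "?p x' \<noteq> 0"
    using x' by (auto simp: measure_pmf_zero_iff)
  moreover have "pmf P (x, y) = (cmod c)\<^sup>2 * pmf P (x', y)" for y
  proof -
    have "pmf P (z, y) = (cmod (\<psi> z y))\<^sup>2" for z
      using emb by (simp add: regular_embedding_def)
    then show ?thesis
      by (simp only: par norm_mult power_mult_distrib)
  qed
  ultimately have scale: "pmf (dependent_part P x) y = s * pmf (dependent_part P x') y" for y
    using x x' by (simp add: pmf_dependent_part s_def)
  have "1 = (\<Sum>y\<in>UNIV. pmf (dependent_part P x) y)"
    by (rule sum_pmf_eq_1[symmetric]) auto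
  also have "\<dots> = s * (\<Sum>y\<in>UNIV. pmf (dependent_part P x') y)"
    by (simp add: scale sum_distrib_left)
  also have "(\<Sum>y\<in>UNIV. pmf (dependent_part P x') y) = 1"
    by (rule sum_pmf_eq_1) auto
  finally show ?thesis
    by (intro pmf_eqI) (simp add: scale)
qed

section \<open>Product states and local measurements\<close>

lemma finite_tuples [simp]: "finite (tuples m :: 'a::finite list set)"
  using finite_lists_length_eq[of "UNIV :: 'a set" m] by (simp add: tuples_def)

lemma tuples_list_update [simp]: "ys[i := b] \<in> tuples m \<longleftrightarrow> ys \<in> tuples m"
  by (simp add: tuples_def)

text \<open>Turns inner products of product vectors into products of inner products.\<close>

lemma sum_tuples_prod:
  fixes f :: "nat \<Rightarrow> 'a::finite \<Rightarrow> 'b::comm_semiring_1"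
  shows "(\<Sum>ys\<in>tuples m. \<Prod>i<m. f i (ys ! i)) = (\<Prod>i<m. \<Sum>y\<in>UNIV. f i y)"
proof (induction m arbitrary: f)
  case 0
  have "tuples 0 = {[] :: 'a list}"
    by (auto simp: tuples_def)
  then show ?case
    by simp
next
  case (Suc m)
  have "bij_betw (\<lambda>(y, ys). y # ys) (UNIV \<times> tuples m) (tuples (Suc m) :: 'a list set)"
    by (rule bij_betwI[where g = "\<lambda>ys. (hd ys, tl ys)"])
      (auto simp: tuples_def length_Suc_conv)
  then have "(\<Sum>ys\<in>tuples (Suc m). \<Prod>i<Suc m. f i (ys ! i)) =
    (\<Sum>(y, ys)\<in>UNIV \<times> tuples m. \<Prod>i<Suc m. f i ((y # ys) ! i))"
    by (subst sum.reindex_bij_betw[symmetric]) (auto simp: case_prod_unfold)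
  also have "\<dots> = (\<Sum>y\<in>UNIV. \<Sum>ys\<in>tuples m. f 0 y * (\<Prod>i<m. f (Suc i) (ys ! i)))"
    by (simp add: sum.cartesian_product prod.lessThan_Suc_shift del: prod.lessThan_Suc)
  also have "\<dots> = (\<Sum>y\<in>UNIV. f 0 y) * (\<Prod>i<m. \<Sum>y\<in>UNIV. f (Suc i) y)"
    by (simp add: sum_distrib_left[symmetric] sum_distrib_right[symmetric] Suc.IH[of "\<lambda>i. f (Suc i)"])
  finally show ?case
    by (simp add: prod.lessThan_Suc_shift del: prod.lessThan_Suc)
qed

text \<open>Exchanging entry \<open>i\<close> with the extra letter is an involution on the index
  pairs. It swaps the input and output indices of an operator inserted by
  \<open>apply_at\<close>.\<close>

lemma sum_tuples_exchange:
  fixes H :: "'a::finite list \<Rightarrow> 'a \<Rightarrow> 'b::comm_monoid_add"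
  assumes "i < m"
  shows "(\<Sum>ys\<in>tuples m. \<Sum>b\<in>UNIV. H ys b) =
    (\<Sum>ys\<in>tuples m. \<Sum>b\<in>UNIV. H (ys[i := b]) (ys ! i))"
proof -
  have "bij_betw (\<lambda>(ys, b). (ys[i := b], ys ! i)) (tuples m \<times> UNIV) (tuples m \<times> (UNIV :: 'a set))"
    by (rule bij_betwI[where g = "\<lambda>(ys, b). (ys[i := b], ys ! i)"])
      (use assms in \<open>auto simp: tuples_def\<close>)
  from sum.reindex_bij_betw[OF this, of "\<lambda>(ys, b). H ys b"] show ?thesis
    by (simp add: sum.cartesian_product case_prod_unfold)
qed

definition overlap :: "nat \<Rightarrow> ('x list \<Rightarrow> 'y::finite list \<Rightarrow> complex) \<Rightarrow> 'x list \<Rightarrow> 'x list \<Rightarrow> complex" where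
  "overlap m w xs xs' = (\<Sum>ys\<in>tuples m. cnj (w xs ys) * w xs' ys)"

definition mass :: "nat \<Rightarrow> ('x list \<Rightarrow> 'y::finite list \<Rightarrow> complex) \<Rightarrow> 'x list \<Rightarrow> real" where
  "mass m w xs = (\<Sum>ys\<in>tuples m. (cmod (w xs ys))\<^sup>2)"

lemma mass_nonneg [simp]: "0 \<le> mass m w xs"
  by (simp add: mass_def sum_nonneg)

lemma overlap_self: "overlap m w xs xs = of_real (mass m w xs)"
  by (simp add: overlap_def mass_def complex_norm_square mult.commute del: of_real_power)

text \<open>The arithmetic-geometric mean inequality is used so that the bound is linear in the
  masses and can be summed over branches.\<close>

lemma overlap_le_mass: "2 * cmod (overlap m w xs xs') \<le> mass m w xs + mass m w xs'"
proof -
  have "2 * cmod (overlap m w xs xs') \<le> (\<Sum>ys\<in>tuples m. 2 * cmod (w xs ys) * cmod (w xs' ys))"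
    using norm_sum[of "\<lambda>ys. cnj (w xs ys) * w xs' ys" "tuples m"]
    by (simp add: overlap_def norm_mult sum_distrib_left[symmetric] mult.assoc)
  also have "\<dots> \<le> (\<Sum>ys\<in>tuples m. (cmod (w xs ys))\<^sup>2 + (cmod (w xs' ys))\<^sup>2)"
    by (intro sum_mono sum_squares_bound)
  finally show ?thesis
    by (simp add: mass_def sum.distrib)
qed

text \<open>The completeness relation of the Kraus operators preserves inner products once all
  outcomes are summed, for distinct honest strings as well as equal ones.\<close>

lemma instrument_overlap:
  assumes M: "is_instrument M" and i: "i < m"
  shows "(\<Sum>(j, K)\<in>M. overlap m (apply_at i K w) xs xs') = overlap m w xs xs'"
proof -
  have *: "overlap m (apply_at i K w) xs xs' =
    (\<Sum>ys\<in>tuples m. \<Sum>b'\<in>UNIV. \<Sum>b\<in>UNIV.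
      cnj (K b (ys ! i)) * K b b' * (cnj (w xs ys) * w xs' (ys[i := b'])))" for K
  proof -
    have "overlap m (apply_at i K w) xs xs' =
      (\<Sum>ys\<in>tuples m. \<Sum>b\<in>UNIV. \<Sum>b'\<in>UNIV.
        cnj (K (ys ! i) b) * K (ys ! i) b' * (cnj (w xs (ys[i := b])) * w xs' (ys[i := b'])))"
      unfolding overlap_def apply_at_def cnj_sum sum_product
      by (intro sum.cong refl) simp
    \<comment> \<open>After the exchange, \<open>b\<close> is the output index shared by both
      operators, the one that the completeness relation sums over.\<close>
    also have "\<dots> = (\<Sum>ys\<in>tuples m. \<Sum>b\<in>UNIV. \<Sum>b'\<in>UNIV.
        cnj (K b (ys ! i)) * K b b' * (cnj (w xs ys) * w xs' (ys[i := b'])))"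
      unfolding sum_tuples_exchange[OF i, of "\<lambda>ys b. \<Sum>b'\<in>UNIV.
        cnj (K (ys ! i) b) * K (ys ! i) b' * (cnj (w xs (ys[i := b])) * w xs' (ys[i := b']))"]
      using i by (intro sum.cong refl) (simp add: tuples_def)
    also have "\<dots> = (\<Sum>ys\<in>tuples m. \<Sum>b'\<in>UNIV. \<Sum>b\<in>UNIV.
        cnj (K b (ys ! i)) * K b b' * (cnj (w xs ys) * w xs' (ys[i := b'])))"
      by (intro sum.cong refl sum.swap)
    finally show ?thesis .
  qed
  have "(\<Sum>(j, K)\<in>M. overlap m (apply_at i K w) xs xs') =
    (\<Sum>ys\<in>tuples m. \<Sum>b'\<in>UNIV. \<Sum>(j, K)\<in>M. \<Sum>b\<in>UNIV.
      cnj (K b (ys ! i)) * K b b' * (cnj (w xs ys) * w xs' (ys[i := b'])))"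
    unfolding * case_prod_unfold
    by (subst sum.swap, intro sum.cong refl) (rule sum.swap)
  also have "\<dots> = (\<Sum>ys\<in>tuples m. \<Sum>b'\<in>UNIV. (\<Sum>(j, K)\<in>M. \<Sum>b\<in>UNIV.
      cnj (K b (ys ! i)) * K b b') * (cnj (w xs ys) * w xs' (ys[i := b'])))"
    by (simp only: case_prod_unfold sum_distrib_right)
  also have "\<dots> = (\<Sum>ys\<in>tuples m. \<Sum>b'\<in>UNIV.
      if ys ! i = b' then cnj (w xs ys) * w xs' (ys[i := b']) else 0)"
    using M by (intro sum.cong refl) (simp add: is_instrument_def)
  also have "\<dots> = overlap m w xs xs'"
    by (simp add: overlap_def)
  finally show ?thesis .
qed

lemma instrument_mass:
  assumes "is_instrument M" "i < m"
  shows "(\<Sum>(j, K)\<in>M. mass m (apply_at i K w) xs) = mass m w xs"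
proof -
  have "complex_of_real (\<Sum>(j, K)\<in>M. mass m (apply_at i K w) xs) = of_real (mass m w xs)"
    using instrument_overlap[OF assms, of w xs xs] by (simp add: overlap_self case_prod_unfold)
  then show ?thesis
    by (simp only: of_real_eq_iff)
qed

text \<open>One family \<open>u\<close> serves all honest strings at once, and factor
  \<open>i\<close> sees only the letter \<open>xs ! i\<close>. Constant and mixed strings over
  \<open>x\<close>, \<open>x'\<close> are thus built from the same factors.\<close>

definition product_state :: "nat \<Rightarrow> ('x list \<Rightarrow> 'y list \<Rightarrow> complex) \<Rightarrow> bool" where
  "product_state m w \<longleftrightarrow> (\<exists>u. \<forall>xs\<in>tuples m. \<forall>ys\<in>tuples m. w xs ys = (\<Prod>i<m. u i (xs ! i) (ys ! i)))"

lemma product_state_tensor_power: "product_state m (tensor_power m \<psi>)"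
  unfolding product_state_def tensor_power_def by (intro exI[of _ "\<lambda>i. \<psi>"]) simp

text \<open>This is where locality of the queries enters: \<open>K\<close> alters factor
  \<open>i\<close> only.\<close>

lemma product_state_apply_at:
  assumes "product_state m w" "i < m"
  shows "product_state m (apply_at i K w)"
proof -
  obtain u where u: "w xs ys = (\<Prod>j<m. u j (xs ! j) (ys ! j))"
    if "xs \<in> tuples m" "ys \<in> tuples m" for xs ys
    using assms(1) unfolding product_state_def by blast
  define u' where "u' = u(i := \<lambda>x y. \<Sum>b\<in>UNIV. K y b * u i x b)"
  have "apply_at i K w xs ys = (\<Prod>j<m. u' j (xs ! j) (ys ! j))"
    if xs: "xs \<in> tuples m" and ys: "ys \<in> tuples m" for xs ys
  proof -
    let ?R = "\<Prod>j\<in>{..<m} - {i}. u j (xs ! j) (ys ! j)"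
    have split: "(\<Prod>j<m. g j) = g i * (\<Prod>j\<in>{..<m} - {i}. g j)" for g :: "nat \<Rightarrow> complex"
      using assms(2) by (intro prod.remove) auto
    have "w xs (ys[i := b]) = u i (xs ! i) b * ?R" for b
    proof -
      have "w xs (ys[i := b]) = (\<Prod>j<m. u j (xs ! j) (ys[i := b] ! j))"
        using xs ys by (intro u) auto
      also have "\<dots> = u i (xs ! i) b * ?R"
        using ys assms(2) unfolding split by (auto simp: tuples_def intro!: prod.cong arg_cong2[where f = times])
      finally show ?thesis .
    qed
    moreover have "(\<Prod>j<m. u' j (xs ! j) (ys ! j)) = (\<Sum>b\<in>UNIV. K (ys ! i) b * u i (xs ! i) b) * ?R"
      unfolding split by (auto simp: u'_def)
    ultimately show ?thesis
      by (simp add: apply_at_def sum_distrib_right mult.assoc)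
  qed
  then show ?thesis
    unfolding product_state_def by blast
qed

text \<open>A vanishing product state has a vanishing factor \<open>u i (zs ! i)\<close>. As
  \<open>zs ! i\<close> is \<open>x\<close> or \<open>x'\<close>, the same zero vector sits at
  position \<open>i\<close> of one of the two constant strings.\<close>

lemma overlap_product_state_eq_0:
  assumes w: "product_state m w" and z: "mass m w zs = 0"
    and zs: "zs \<in> tuples m" "set zs \<subseteq> {x, x'}"
  shows "overlap m w (replicate m x) (replicate m x') = 0"
proof -
  obtain u where u: "w xs ys = (\<Prod>j<m. u j (xs ! j) (ys ! j))"
    if "xs \<in> tuples m" "ys \<in> tuples m" for xs ys
    using w unfolding product_state_def by blast
  have ov: "overlap m w xs xs' = (\<Prod>i<m. \<Sum>y\<in>UNIV. cnj (u i (xs ! i) y) * u i (xs' ! i) y)"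
    if "xs \<in> tuples m" "xs' \<in> tuples m" for xs xs'
  proof -
    have "overlap m w xs xs' = (\<Sum>ys\<in>tuples m. \<Prod>i<m. cnj (u i (xs ! i) (ys ! i)) * u i (xs' ! i) (ys ! i))"
      unfolding overlap_def using that by (intro sum.cong refl) (simp add: u prod.distrib)
    then show ?thesis
      by (simp only: sum_tuples_prod[where f = "\<lambda>i y. cnj (u i (xs ! i) y) * u i (xs' ! i) y"])
  qed
  have "(\<Prod>i<m. \<Sum>y\<in>UNIV. cnj (u i (zs ! i) y) * u i (zs ! i) y) = 0"
    using z ov[OF zs(1) zs(1)] overlap_self[of m w zs] by simp
  then obtain i where i: "i < m" and "(\<Sum>y\<in>UNIV. cnj (u i (zs ! i) y) * u i (zs ! i) y) = 0"
    by auto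
  then have "complex_of_real (\<Sum>y\<in>UNIV. (cmod (u i (zs ! i) y))\<^sup>2) = 0"
    by (simp add: complex_norm_square mult.commute del: of_real_power)
  then have "u i (zs ! i) y = 0" for y
    by (simp only: of_real_eq_0_iff) (simp add: sum_nonneg_eq_0_iff)
  moreover have "zs ! i \<in> {x, x'}"
    using zs i by (auto simp: tuples_def dest: nth_mem)
  ultimately have "(\<Sum>y\<in>UNIV. cnj (u i x y) * u i x' y) = 0"
    by auto
  then show ?thesis
    using i by (subst ov) (auto simp: tuples_def intro!: bexI[of _ i])
qed

section \<open>Simulators\<close>

lemma integrable_pmf_bounded:
  fixes f :: "'a \<Rightarrow> real"
  assumes "\<And>a. a \<in> set_pmf p \<Longrightarrow> 0 \<le> f a" "\<And>a. a \<in> set_pmf p \<Longrightarrow> f a \<le> B"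
  shows "integrable (measure_pmf p) f"
  using assms
  by (intro measure_pmf.integrable_const_bound[where B = B]) (auto simp: AE_measure_pmf_iff)

lemma expectation_mono_pmf:
  fixes f g :: "'a \<Rightarrow> real"
  assumes "integrable (measure_pmf p) f" "integrable (measure_pmf p) g"
    and "\<And>a. a \<in> set_pmf p \<Longrightarrow> f a \<le> g a"
  shows "measure_pmf.expectation p f \<le> measure_pmf.expectation p g"
  using assms by (intro integral_mono_AE) (auto simp: AE_measure_pmf_iff)

lemma expectation_bounds_pmf:
  fixes f :: "'a \<Rightarrow> real"
  assumes "\<And>a. a \<in> set_pmf p \<Longrightarrow> 0 \<le> f a" "\<And>a. a \<in> set_pmf p \<Longrightarrow> f a \<le> B"
  shows "0 \<le> measure_pmf.expectation p f" "measure_pmf.expectation p f \<le> B"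
  using expectation_mono_pmf[of p "\<lambda>_. 0" f] expectation_mono_pmf[of p f "\<lambda>_. B"] assms
    integrable_pmf_bounded[of p f B] by auto

lemma expectation_pmf_eq_0_D:
  fixes f :: "'a \<Rightarrow> real"
  assumes "integrable (measure_pmf p) f" "\<And>a. a \<in> set_pmf p \<Longrightarrow> 0 \<le> f a"
    and "measure_pmf.expectation p f = 0" "a \<in> set_pmf p"
  shows "f a = 0"
proof -
  have "AE a in measure_pmf p. 0 \<le> f a"
    using assms(2) by (auto simp: AE_measure_pmf_iff)
  then have "AE a in measure_pmf p. f a = 0"
    using assms(1,3) by (simp add: integral_nonneg_eq_0_iff_AE)
  then show ?thesis
    using assms(4) by (simp add: AE_measure_pmf_iff)
qed

section \<open>Probability balance of a simulator run\<close>

locale simulation =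
  fixes m :: nat and F :: "real \<Rightarrow> 'y::finite instrument" and \<sigma> :: simulator
  assumes interface: "is_interface F" and simulator: "is_simulator m \<sigma>"
begin

lemma query:
  assumes "Query i s \<in> set_pmf (\<sigma> h)"
  shows "i < m" "is_instrument (F s)" "finite (F s)"
  using assms interface simulator
  by (auto simp: is_interface_def is_simulator_def is_instrument_def)

text \<open>The integrand in the recursion for \<open>sim_prob\<close>, named so that bounds and
  vanishing can be stated for a single action.\<close>

definition final_step ::
    "nat \<Rightarrow> transcript \<Rightarrow> ('x list \<Rightarrow> 'y list \<Rightarrow> complex) \<Rightarrow> 'x list \<Rightarrow> nat \<Rightarrow> action \<Rightarrow> real" where
  "final_step n h w xs k act = (case act of
       Final k' \<Rightarrow> if k' = k then mass m w xs else 0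
     | Query i s \<Rightarrow> \<Sum>(j, K)\<in>F s. sim_prob m F \<sigma> n (h @ [(i, s, j)]) (apply_at i K w) xs k)"

lemma sim_prob_Suc:
  "sim_prob m F \<sigma> (Suc n) h w xs k = measure_pmf.expectation (\<sigma> h) (final_step n h w xs k)"
  unfolding final_step_def[abs_def] mass_def by simp

text \<open>The probability that the honest party obtains \<open>xs\<close> and the simulator has not stopped after
  \<open>n\<close> actions.\<close>

primrec running_prob ::
    "nat \<Rightarrow> transcript \<Rightarrow> ('x list \<Rightarrow> 'y list \<Rightarrow> complex) \<Rightarrow> 'x list \<Rightarrow> real" where
  "running_prob 0 h w xs = mass m w xs"
| "running_prob (Suc n) h w xs =
     measure_pmf.expectation (\<sigma> h) (\<lambda>act. case act of
         Final k \<Rightarrow> 0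
       | Query i s \<Rightarrow> \<Sum>(j, K)\<in>F s. running_prob n (h @ [(i, s, j)]) (apply_at i K w) xs)"

definition running_step ::
    "nat \<Rightarrow> transcript \<Rightarrow> ('x list \<Rightarrow> 'y list \<Rightarrow> complex) \<Rightarrow> 'x list \<Rightarrow> action \<Rightarrow> real" where
  "running_step n h w xs act = (case act of
       Final k \<Rightarrow> 0
     | Query i s \<Rightarrow> \<Sum>(j, K)\<in>F s. running_prob n (h @ [(i, s, j)]) (apply_at i K w) xs)"

lemma running_prob_Suc:
  "running_prob (Suc n) h w xs = measure_pmf.expectation (\<sigma> h) (running_step n h w xs)"
  by (simp add: running_step_def[abs_def])

text \<open>A query splits the mass exactly among its branches, so a bound by the mass passes
  through. The general \<open>f\<close> covers \<open>sim_prob\<close> and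
  \<open>running_prob\<close> alike.\<close>

lemma query_bounds:
  fixes f :: "transcript \<Rightarrow> ('x list \<Rightarrow> 'y list \<Rightarrow> complex) \<Rightarrow> real"
  assumes "Query i s \<in> set_pmf (\<sigma> h)" and f: "\<And>h w. 0 \<le> f h w \<and> f h w \<le> mass m w xs"
  shows "0 \<le> (\<Sum>(j, K)\<in>F s. f (h @ [(i, s, j)]) (apply_at i K w))"
    and "(\<Sum>(j, K)\<in>F s. f (h @ [(i, s, j)]) (apply_at i K w)) \<le> mass m w xs"
  using f unfolding instrument_mass[OF query(2,1)[OF assms(1)], of w xs, symmetric]
  by (auto intro!: sum_nonneg sum_mono)

text \<open>The bound on \<open>sim_prob\<close> is a premise because the lemma serves inside the
  induction that establishes this bound; \<open>final_step_bounds'\<close> discharges it.\<close>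

lemma final_step_bounds:
  assumes "a \<in> set_pmf (\<sigma> h)" "\<And>h w. 0 \<le> sim_prob m F \<sigma> n h w xs k \<and> sim_prob m F \<sigma> n h w xs k \<le> mass m w xs"
  shows "0 \<le> final_step n h w xs k a" "final_step n h w xs k a \<le> mass m w xs"
  using assms(1) query_bounds[of _ _ h "\<lambda>h w. sim_prob m F \<sigma> n h w xs k" xs w] assms(2)
  by (auto simp: final_step_def split: action.split)

lemma running_step_bounds:
  assumes "a \<in> set_pmf (\<sigma> h)" "\<And>h w. 0 \<le> running_prob n h w xs \<and> running_prob n h w xs \<le> mass m w xs"
  shows "0 \<le> running_step n h w xs a" "running_step n h w xs a \<le> mass m w xs"
  using assms(1) query_bounds[of _ _ h "\<lambda>h w. running_prob n h w xs" xs w] assms(2)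
  by (auto simp: running_step_def split: action.split)

lemma sim_prob_bounds: "0 \<le> sim_prob m F \<sigma> n h w xs k \<and> sim_prob m F \<sigma> n h w xs k \<le> mass m w xs"
proof (induction n arbitrary: h w)
  case (Suc n)
  show ?case
    using expectation_bounds_pmf[of "\<sigma> h" "final_step n h w xs k" "mass m w xs"]
      final_step_bounds[OF _ Suc.IH] by (simp only: sim_prob_Suc)
qed simp

lemma running_prob_bounds: "0 \<le> running_prob n h w xs \<and> running_prob n h w xs \<le> mass m w xs"
proof (induction n arbitrary: h w)
  case (Suc n)
  show ?case
    using expectation_bounds_pmf[of "\<sigma> h" "running_step n h w xs" "mass m w xs"]
      running_step_bounds[OF _ Suc.IH] by (simp only: running_prob_Suc)
qed simp

lemmas final_step_bounds' = final_step_bounds[OF _ sim_prob_bounds]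
lemmas running_step_bounds' = running_step_bounds[OF _ running_prob_bounds]

lemma integrable_final_step [simp]: "integrable (measure_pmf (\<sigma> h)) (final_step n h w xs k)"
  by (rule integrable_pmf_bounded[OF final_step_bounds'])

lemma integrable_running_step [simp]: "integrable (measure_pmf (\<sigma> h)) (running_step n h w xs)"
  by (rule integrable_pmf_bounded[OF running_step_bounds'])

text \<open>Owing to this monotonicity, a value of limiting probability 0 has probability 0 at every
  finite stage.\<close>

lemma sim_prob_le_Suc: "sim_prob m F \<sigma> n h w xs k \<le> sim_prob m F \<sigma> (Suc n) h w xs k"
proof (induction n arbitrary: h w)
  case 0
  then show ?case
    using sim_prob_bounds[of "Suc 0" h w xs k] by simp
next
  case (Suc n)
  have "final_step n h w xs k a \<le> final_step (Suc n) h w xs k a" for a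
    using Suc.IH by (auto simp: final_step_def intro!: sum_mono simp del: sim_prob.simps split: action.split)
  then show ?case
    unfolding sim_prob_Suc by (intro expectation_mono_pmf) auto
qed

text \<open>Every action conserves mass, either assigning it to one final value or splitting it
  among outcomes. Equality can fail because the simulator may stop with a value of at least
  \<open>r\<close>.\<close>

lemma running_plus_sim_le_mass:
  "running_prob n h w xs + (\<Sum>k<r. sim_prob m F \<sigma> n h w xs k) \<le> mass m w xs"
proof (induction n arbitrary: h w)
  case (Suc n)
  let ?f = "\<lambda>a. running_step n h w xs a + (\<Sum>k<r. final_step n h w xs k a)"
  have "0 \<le> ?f a" "?f a \<le> mass m w xs" if a: "a \<in> set_pmf (\<sigma> h)" for a
  proof -
    show "0 \<le> ?f a"
      using a by (intro add_nonneg_nonneg sum_nonneg running_step_bounds' final_step_bounds')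
    show "?f a \<le> mass m w xs"
    proof (cases a)
      case (Query i s)
      have "?f a = (\<Sum>(j, K)\<in>F s. running_prob n (h @ [(i, s, j)]) (apply_at i K w) xs +
          (\<Sum>k<r. sim_prob m F \<sigma> n (h @ [(i, s, j)]) (apply_at i K w) xs k))"
        by (simp add: Query running_step_def final_step_def case_prod_unfold sum.distrib
            sum.swap[of _ "F s"])
      also have "\<dots> \<le> mass m w xs"
        using query(1,2)[OF a[unfolded Query]] Suc.IH
        unfolding instrument_mass[OF query(2,1)[OF a[unfolded Query]], of w xs, symmetric]
        by (auto intro!: sum_mono)
      finally show ?thesis .
    qed (auto simp: running_step_def final_step_def)
  qed
  then have "measure_pmf.expectation (\<sigma> h) ?f \<le> mass m w xs"
    by (intro expectation_bounds_pmf)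
  then show ?case
    by (simp add: sim_prob_Suc running_prob_Suc del: sim_prob.simps running_prob.simps)
qed simp

text \<open>A measurement on one copy cannot annihilate the overlap on every branch. Hence a simulator that
  never gives an answer excluded by the honest outcomes has to keep running on a branch that still
  carries overlap.\<close>

lemma overlap_le_running:
  assumes "product_state m w"
    and "\<And>k. \<exists>xs\<in>tuples m. set xs \<subseteq> {x, x'} \<and> sim_prob m F \<sigma> n h w xs k = 0"
  shows "2 * cmod (overlap m w (replicate m x) (replicate m x')) \<le>
    running_prob n h w (replicate m x) + running_prob n h w (replicate m x')"
  using assms
proof (induction n arbitrary: h w)
  case 0
  then show ?case
    by (simp add: overlap_le_mass)
next
  case (Suc n)
  let ?ov = "\<lambda>w. overlap m w (replicate m x) (replicate m x')"
  let ?f = "\<lambda>a. running_step n h w (replicate m x) a + running_step n h w (replicate m x') a"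
  \<comment> \<open>A vanishing expectation of nonnegative terms vanishes at each action of positive
    probability.\<close>
  have excl: "\<exists>xs\<in>tuples m. set xs \<subseteq> {x, x'} \<and> final_step n h w xs k a = 0"
    if "a \<in> set_pmf (\<sigma> h)" for a k
    using Suc.prems(2)[of k] that
    unfolding sim_prob_Suc by (meson expectation_pmf_eq_0_D final_step_bounds'(1) integrable_final_step)
  have "2 * cmod (?ov w) \<le> ?f a" if a: "a \<in> set_pmf (\<sigma> h)" for a
  proof (cases a)
    case (Final k)
    \<comment> \<open>Stopping with \<open>k\<close> means that the string excluded for
      \<open>k\<close> has mass 0, which kills the overlap of a product state.\<close>
    then have "?ov w = 0"
      using excl[OF a, of k] overlap_product_state_eq_0[OF Suc.prems(1)]
      by (auto simp: final_step_def)
    then show ?thesis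
      by (simp add: running_step_def Final)
  next
    case (Query i s)
    note q = query[OF a[unfolded Query]]
    have le: "2 * cmod (?ov (apply_at i K w)) \<le>
        running_prob n (h @ [(i, s, j)]) (apply_at i K w) (replicate m x) +
        running_prob n (h @ [(i, s, j)]) (apply_at i K w) (replicate m x')" if jK: "(j, K) \<in> F s" for j K
    proof (rule Suc.IH)
      show "product_state m (apply_at i K w)"
        using Suc.prems(1) q(1) by (rule product_state_apply_at)
      fix k
      obtain xs where xs: "xs \<in> tuples m" "set xs \<subseteq> {x, x'}" "final_step n h w xs k a = 0"
        using excl[OF a] by blast
      \<comment> \<open>All branches contribute nonnegatively, so each inherits the exclusion of
        \<open>k\<close>, with the same string.\<close>
      have "(\<Sum>(j, K)\<in>F s. sim_prob m F \<sigma> n (h @ [(i, s, j)]) (apply_at i K w) xs k) = 0"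
        using xs(3) by (simp add: final_step_def Query)
      then have "sim_prob m F \<sigma> n (h @ [(i, s, j)]) (apply_at i K w) xs k = 0"
        using q(3) jK sim_prob_bounds[THEN conjunct1] by (subst (asm) sum_nonneg_eq_0_iff) auto
      then show "\<exists>xs\<in>tuples m. set xs \<subseteq> {x, x'} \<and>
          sim_prob m F \<sigma> n (h @ [(i, s, j)]) (apply_at i K w) xs k = 0"
        using xs by blast
    qed
    have "2 * cmod (?ov w) \<le> (\<Sum>(j, K)\<in>F s. 2 * cmod (?ov (apply_at i K w)))"
      using norm_sum[of "\<lambda>(j, K). ?ov (apply_at i K w)" "F s"]
      unfolding instrument_overlap[OF q(2,1), of w, symmetric]
      by (simp add: case_prod_unfold sum_distrib_left[symmetric])
    also have "\<dots> \<le> (\<Sum>(j, K)\<in>F s. running_prob n (h @ [(i, s, j)]) (apply_at i K w) (replicate m x) +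
        running_prob n (h @ [(i, s, j)]) (apply_at i K w) (replicate m x'))"
      using le by (auto intro!: sum_mono)
    also have "\<dots> = ?f a"
      by (simp add: running_step_def Query case_prod_unfold sum.distrib)
    finally show ?thesis .
  qed
  then have "measure_pmf.expectation (\<sigma> h) (\<lambda>_. 2 * cmod (?ov w)) \<le> measure_pmf.expectation (\<sigma> h) ?f"
    by (intro expectation_mono_pmf) auto
  then show ?case
    by (simp add: running_prob_Suc del: running_prob.simps)
qed

end

text \<open>By completeness of the POVM, the limits demanded of a simulator exhaust the mass and
  leave none for runs that never stop.\<close>

lemma attack_prob_sum:
  assumes "is_povm (tuples m) r E"
  shows "(\<Sum>k<r. attack_prob m \<psi> r E xs k) = mass m (tensor_power m \<psi>) xs"
proof -
  let ?w = "tensor_power m \<psi> xs"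
  have "(\<Sum>k<r. attack_prob m \<psi> r E xs k) =
    Re (\<Sum>ys\<in>tuples m. \<Sum>ys'\<in>tuples m. cnj (?w ys) * (\<Sum>k<r. E k ys ys') * ?w ys')"
    by (simp add: attack_prob_def Re_sum[symmetric] sum_distrib_left sum_distrib_right
        sum.swap[of _ _ "{..<r}"] del: Re_sum)
  also have "\<dots> = Re (\<Sum>ys\<in>tuples m. \<Sum>ys'\<in>tuples m. if ys = ys' then cnj (?w ys) * ?w ys' else 0)"
    using assms by (intro arg_cong[where f = Re] sum.cong) (auto simp: is_povm_def)
  also have "\<dots> = Re (overlap m (tensor_power m \<psi>) xs xs)"
    by (simp add: overlap_def)
  finally show ?thesis
    by (simp add: overlap_self)
qed

text \<open>The initial overlap is a fixed nonzero number, while the running probabilities that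
  bound it tend to 0. Letting \<open>n\<close> grow covers simulators without a bound on their
  queries.\<close>

lemma excluding_attack_not_simulated:
  fixes \<psi> :: "'x \<Rightarrow> 'y::finite \<Rightarrow> complex"
  assumes F: "is_interface F" and \<sigma>: "is_simulator m \<sigma>" and povm: "is_povm (tuples m) r E"
    and excl: "\<And>k. k < r \<Longrightarrow> \<exists>xs\<in>tuples m. set xs \<subseteq> {x, x'} \<and> attack_prob m \<psi> r E xs k = 0"
    and nonorth: "(\<Sum>y\<in>UNIV. cnj (\<psi> x y) * \<psi> x' y) \<noteq> 0"
  shows "\<not> simulates m \<psi> F \<sigma> r E"
proof
  assume sim: "simulates m \<psi> F \<sigma> r E"
  interpret simulation m F \<sigma>
    by unfold_locales fact+
  let ?w = "tensor_power m \<psi>"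
  have lim: "(\<lambda>n. sim_prob m F \<sigma> n [] ?w xs k) \<longlonglongrightarrow> attack_prob m \<psi> r E xs k"
    if "xs \<in> tuples m" for xs k
    using sim that by (auto simp: simulates_def)
  \<comment> \<open>For \<open>k \<ge> r\<close> the attack probability is 0 by definition, so the
    constant string serves.\<close>
  have excl': "\<exists>xs\<in>tuples m. set xs \<subseteq> {x, x'} \<and> attack_prob m \<psi> r E xs k = 0" for k
    using excl[of k] by (cases "k < r") (auto simp: attack_prob_def tuples_def intro!: exI[of _ "replicate m x"])
  have "\<exists>xs\<in>tuples m. set xs \<subseteq> {x, x'} \<and> sim_prob m F \<sigma> n [] ?w xs k = 0" for n k
  proof -
    obtain xs where xs: "xs \<in> tuples m" "set xs \<subseteq> {x, x'}" "attack_prob m \<psi> r E xs k = 0"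
      using excl' by blast
    have "sim_prob m F \<sigma> n [] ?w xs k \<le> 0"
      using lim[OF xs(1), of k] xs(3) sim_prob_le_Suc by (intro LIMSEQ_le_const incseq_le) (auto intro!: incseq_SucI)
    then show ?thesis
      using xs sim_prob_bounds[of n "[]" ?w xs k] by (intro bexI[of _ xs]) auto
  qed
  then have le: "2 * cmod (overlap m ?w (replicate m x) (replicate m x')) \<le>
      running_prob n [] ?w (replicate m x) + running_prob n [] ?w (replicate m x')" for n
    by (intro overlap_le_running product_state_tensor_power)
  \<comment> \<open>The running part is at most the mass not yet assigned to values below
    \<open>r\<close>, which tends to 0 by \<open>attack_prob_sum\<close>.\<close>
  have run: "(\<lambda>n. running_prob n [] ?w xs) \<longlonglongrightarrow> 0" if xs: "xs \<in> tuples m" for xs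
  proof (rule tendsto_sandwich[OF _ _ tendsto_const])
    have "(\<lambda>n. mass m ?w xs - (\<Sum>k<r. sim_prob m F \<sigma> n [] ?w xs k)) \<longlonglongrightarrow>
      mass m ?w xs - (\<Sum>k<r. attack_prob m \<psi> r E xs k)"
      by (intro tendsto_intros lim xs)
    then show "(\<lambda>n. mass m ?w xs - (\<Sum>k<r. sim_prob m F \<sigma> n [] ?w xs k)) \<longlonglongrightarrow> 0"
      by (simp add: attack_prob_sum[OF povm])
    show "\<forall>\<^sub>F n in sequentially. running_prob n [] ?w xs \<le>
        mass m ?w xs - (\<Sum>k<r. sim_prob m F \<sigma> n [] ?w xs k)"
      using running_plus_sim_le_mass[of _ "[]" ?w xs r] by (simp add: le_diff_eq)
  qed (simp add: running_prob_bounds[THEN conjunct1])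
  have "2 * cmod (overlap m ?w (replicate m x) (replicate m x')) \<le> 0 + 0"
    by (rule LIMSEQ_le_const[OF tendsto_add[OF run run]]) (use le in \<open>auto simp: tuples_def\<close>)
  moreover have "overlap m ?w (replicate m x) (replicate m x') = (\<Sum>y\<in>UNIV. cnj (\<psi> x y) * \<psi> x' y) ^ m"
    using sum_tuples_prod[where f = "\<lambda>i y. cnj (\<psi> x y) * \<psi> x' y" and m = m]
    by (simp add: overlap_def tensor_power_def prod.distrib)
  ultimately show False
    using nonorth by simp
qed

section \<open>Exclusion measurements\<close>

definition inner_on :: "'i set \<Rightarrow> ('i \<Rightarrow> complex) \<Rightarrow> ('i \<Rightarrow> complex) \<Rightarrow> complex" where
  "inner_on I f g = (\<Sum>i\<in>I. cnj (f i) * g i)"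

lemma cnj_inner_on: "cnj (inner_on I f g) = inner_on I g f"
  by (simp add: inner_on_def mult.commute)

lemma inner_on_self: "inner_on I f f = of_real (\<Sum>i\<in>I. (cmod (f i))\<^sup>2)"
  by (simp add: inner_on_def complex_norm_square mult.commute del: of_real_power)

lemma inner_on_self_nonneg: "Im (inner_on I f f) = 0" "0 \<le> Re (inner_on I f f)"
  unfolding inner_on_self by (simp_all only: Im_complex_of_real Re_complex_of_real sum_nonneg zero_le_power2)

lemma inner_on_add_left: "inner_on I (\<lambda>i. f i + g i) h = inner_on I f h + inner_on I g h"
  by (simp add: inner_on_def distrib_right sum.distrib)

lemma inner_on_add_right: "inner_on I h (\<lambda>i. f i + g i) = inner_on I h f + inner_on I h g"
  by (simp add: inner_on_def distrib_left sum.distrib)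

lemma inner_on_diff_left: "inner_on I (\<lambda>i. f i - g i) h = inner_on I f h - inner_on I g h"
  by (simp add: inner_on_def left_diff_distrib sum_subtractf)

lemma inner_on_diff_right: "inner_on I h (\<lambda>i. f i - g i) = inner_on I h f - inner_on I h g"
  by (simp add: inner_on_def right_diff_distrib sum_subtractf)

lemma inner_on_scale_left: "inner_on I (\<lambda>i. c * f i) g = cnj c * inner_on I f g"
  by (simp add: inner_on_def sum_distrib_left mult.assoc)

lemma inner_on_scale_right: "inner_on I g (\<lambda>i. c * f i) = c * inner_on I g f"
  by (simp add: inner_on_def sum_distrib_left mult.left_commute)

lemma inner_on_sum_left:
  "inner_on I (\<lambda>i. \<Sum>z\<in>Z. c z * T z i) g = (\<Sum>z\<in>Z. cnj (c z) * inner_on I (T z) g)"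
proof -
  have "inner_on I (\<lambda>i. \<Sum>z\<in>Z. c z * T z i) g = (\<Sum>i\<in>I. \<Sum>z\<in>Z. cnj (c z) * (cnj (T z i) * g i))"
    by (simp add: inner_on_def sum_distrib_right mult.assoc)
  also have "\<dots> = (\<Sum>z\<in>Z. cnj (c z) * inner_on I (T z) g)"
    by (subst sum.swap) (simp add: inner_on_def sum_distrib_left)
  finally show ?thesis .
qed

lemma inner_on_sum_right:
  "inner_on I g (\<lambda>i. \<Sum>z\<in>Z. c z * T z i) = (\<Sum>z\<in>Z. c z * inner_on I g (T z))"
  using arg_cong[OF inner_on_sum_left[of I c T Z g], of cnj] by (simp add: cnj_inner_on)

lemma rank_one_form:
  "(\<Sum>i\<in>I. \<Sum>j\<in>I. cnj (v i) * (a i * cnj (a j)) * v j) = inner_on I v a * inner_on I a v"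
  by (simp add: inner_on_def sum_product mult.assoc)

definition orthonormal_on :: "'i set \<Rightarrow> 'z set \<Rightarrow> ('z \<Rightarrow> 'i \<Rightarrow> complex) \<Rightarrow> bool" where
  "orthonormal_on I Z T \<longleftrightarrow> (\<forall>z\<in>Z. \<forall>z'\<in>Z. inner_on I (T z) (T z') = (if z = z' then 1 else 0))"

text \<open>\<open>R v\<close> is the residual of \<open>v\<close> after projection onto the span of
  \<open>T\<close>. It is orthogonal to every \<open>T z\<close>, so its squared norm is
  \<open>inner_on I v (R v)\<close>, the form on the left; positivity follows.\<close>

lemma complement_form:
  assumes "finite I" "finite Z" "orthonormal_on I Z T"
  defines "c \<equiv> \<lambda>v z. inner_on I (T z) v"
  defines "R \<equiv> \<lambda>v i. v i - (\<Sum>z\<in>Z. c v z * T z i)"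
  shows "(\<Sum>i\<in>I. \<Sum>j\<in>I. cnj (v i) * ((if i = j then 1 else 0) - (\<Sum>z\<in>Z. T z i * cnj (T z j))) * v j) =
    inner_on I (R v) (R v)"
proof -
  have c: "inner_on I v (T z) = cnj (c v z)" for z
    by (simp add: c_def cnj_inner_on)
  have "(\<Sum>i\<in>I. \<Sum>j\<in>I. cnj (v i) * (if i = j then 1 else 0) * v j) = inner_on I v v"
    using assms(1) by (simp add: inner_on_def if_distrib[of "\<lambda>x. _ * x"] if_distrib[of "\<lambda>x. x * _"] cong: if_cong)
  moreover have "(\<Sum>i\<in>I. \<Sum>j\<in>I. cnj (v i) * (\<Sum>z\<in>Z. T z i * cnj (T z j)) * v j) =
      (\<Sum>i\<in>I. \<Sum>z\<in>Z. \<Sum>j\<in>I. cnj (v i) * (T z i * cnj (T z j)) * v j)"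
    unfolding sum_distrib_left sum_distrib_right by (intro sum.cong refl sum.swap)
  moreover have "\<dots> = (\<Sum>z\<in>Z. cnj (c v z) * c v z)"
    by (subst sum.swap) (simp add: rank_one_form c, simp add: c_def)
  ultimately have 1: "(\<Sum>i\<in>I. \<Sum>j\<in>I. cnj (v i) * ((if i = j then 1 else 0) - (\<Sum>z\<in>Z. T z i * cnj (T z j))) * v j) =
      inner_on I v v - (\<Sum>z\<in>Z. cnj (c v z) * c v z)"
    by (simp only: right_diff_distrib left_diff_distrib sum_subtractf)
  have orth: "inner_on I (T z) (R v) = 0" if "z \<in> Z" for z
  proof -
    have "(\<Sum>z'\<in>Z. c v z' * inner_on I (T z) (T z')) = (\<Sum>z'\<in>Z. if z = z' then c v z' else 0)"
      using assms(3) that by (intro sum.cong) (auto simp: orthonormal_on_def)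
    then show ?thesis
      using that assms(2) by (simp add: R_def inner_on_diff_right inner_on_sum_right c_def)
  qed
  have "inner_on I (R v) (R v) = inner_on I v (R v) - (\<Sum>z\<in>Z. cnj (c v z) * inner_on I (T z) (R v))"
    by (subst (1) R_def) (simp add: inner_on_diff_left inner_on_sum_left)
  also have "\<dots> = inner_on I v v - (\<Sum>z\<in>Z. cnj (c v z) * c v z)"
    by (simp add: orth) (simp add: R_def inner_on_diff_right inner_on_sum_right c mult.commute[of "cnj _"])
  finally show ?thesis
    using 1 by simp
qed

text \<open>Vectors in the span leave no residual, so the complementary outcome never occurs on
  them.\<close>

lemma complement_form_span:
  assumes "finite I" "finite Z" "orthonormal_on I Z T" "\<And>i. i \<in> I \<Longrightarrow> v i = (\<Sum>z\<in>Z. g z * T z i)"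
  shows "(\<Sum>i\<in>I. \<Sum>j\<in>I. cnj (v i) * ((if i = j then 1 else 0) - (\<Sum>z\<in>Z. T z i * cnj (T z j))) * v j) = 0"
proof -
  have "inner_on I (T z) v = g z" if z: "z \<in> Z" for z
  proof -
    have "inner_on I (T z) v = inner_on I (T z) (\<lambda>i. \<Sum>z\<in>Z. g z * T z i)"
      using assms(4) by (simp add: inner_on_def)
    also have "\<dots> = (\<Sum>z'\<in>Z. if z = z' then g z' else 0)"
      unfolding inner_on_sum_right using assms(3) z by (intro sum.cong) (auto simp: orthonormal_on_def)
    finally show ?thesis
      using z assms(2) by simp
  qed
  then have R: "v i - (\<Sum>z\<in>Z. inner_on I (T z) v * T z i) = 0" if "i \<in> I" for i
    using assms(4)[OF that] by simp
  show ?thesis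
    unfolding complement_form[OF assms(1-3)]
    by (subst inner_on_def) (intro sum.neutral ballI, simp only: R mult_zero_right)
qed

text \<open>The condition on \<open>h\<close> says that its columns, indexed by \<open>Z\<close>,
  are orthonormal. Hence the vectors \<open>\<Xi> b\<close> resolve the projection onto the span of
  \<open>T\<close>, and the complementary projection completes the POVM.\<close>

lemma povm_from_orthonormal:
  fixes T :: "'z \<Rightarrow> 'i \<Rightarrow> complex" and h :: "'b \<Rightarrow> 'z \<Rightarrow> complex"
  assumes fin: "finite I" "finite Z" "finite B" and T: "orthonormal_on I Z T"
    and h: "\<And>z z'. z \<in> Z \<Longrightarrow> z' \<in> Z \<Longrightarrow> (\<Sum>b\<in>B. h b z * cnj (h b z')) = (if z = z' then 1 else 0)"
  defines "\<Xi> \<equiv> \<lambda>b i. \<Sum>z\<in>Z. h b z * T z i"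
  obtains r E where "is_povm I r E"
    and "\<And>k. k < r \<Longrightarrow> (\<exists>b\<in>B. E k = (\<lambda>i j. \<Xi> b i * cnj (\<Xi> b j))) \<or>
      E k = (\<lambda>i j. (if i = j then 1 else 0) - (\<Sum>z\<in>Z. T z i * cnj (T z j)))"
proof -
  obtain e where e: "bij_betw e {..<card B} B"
    using ex_bij_betw_nat_finite[OF fin(3)] by (auto simp: atLeast0LessThan)
  define Q where "Q = (\<lambda>i j. (if i = j then 1 else 0) - (\<Sum>z\<in>Z. T z i * cnj (T z j)))"
  \<comment> \<open>Outcomes below \<open>card B\<close> enumerate \<open>B\<close>; one further
    outcome, numbered \<open>card B\<close>, is \<open>Q\<close>.\<close>
  define E where "E = (\<lambda>k. if k < card B then (\<lambda>i j. \<Xi> (e k) i * cnj (\<Xi> (e k) j)) else Q)"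
  have "positive_semidefinite I (\<lambda>i j. a i * cnj (a j))" for a :: "'i \<Rightarrow> complex"
  proof -
    have "inner_on I v a * inner_on I a v = of_real ((cmod (inner_on I a v))\<^sup>2)" for v
      unfolding complex_norm_square cnj_inner_on by (rule mult.commute)
    then show ?thesis
      by (simp add: positive_semidefinite_def rank_one_form Let_def del: of_real_power)
  qed
  moreover have "positive_semidefinite I Q"
    unfolding positive_semidefinite_def Q_def complement_form[OF fin(1,2) T] Let_def
    by (intro allI conjI inner_on_self_nonneg)
  moreover have "(\<Sum>k<Suc (card B). E k i j) = (if i = j then 1 else 0)" for i j
  proof -
    have "(\<Sum>k<card B. E k i j) = (\<Sum>k<card B. \<Xi> (e k) i * cnj (\<Xi> (e k) j))"
      by (simp add: E_def)
    also have "\<dots> = (\<Sum>b\<in>B. \<Xi> b i * cnj (\<Xi> b j))"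
      by (rule sum.reindex_bij_betw[OF e])
    also have "\<dots> = (\<Sum>b\<in>B. \<Sum>z\<in>Z. \<Sum>z'\<in>Z. h b z * cnj (h b z') * (T z i * cnj (T z' j)))"
      unfolding \<Xi>_def cnj_sum sum_product by (intro sum.cong refl) simp
    also have "\<dots> = (\<Sum>z\<in>Z. \<Sum>z'\<in>Z. \<Sum>b\<in>B. h b z * cnj (h b z') * (T z i * cnj (T z' j)))"
      by (subst sum.swap, intro sum.cong refl) (rule sum.swap)
    also have "\<dots> = (\<Sum>z\<in>Z. \<Sum>z'\<in>Z. if z = z' then T z i * cnj (T z' j) else 0)"
      unfolding sum_distrib_right[symmetric] by (intro sum.cong refl) (simp add: h)
    also have "\<dots> = (\<Sum>z\<in>Z. T z i * cnj (T z j))"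
      using fin by simp
    finally show ?thesis
      by (simp add: E_def Q_def)
  qed
  ultimately have "is_povm I (Suc (card B)) E"
    by (auto simp: is_povm_def E_def)
  moreover have "(\<exists>b\<in>B. E k = (\<lambda>i j. \<Xi> b i * cnj (\<Xi> b j))) \<or> E k = Q" if "k < Suc (card B)" for k
    using bij_betwE[OF e] by (auto simp: E_def)
  ultimately show thesis
    using that unfolding Q_def by blast
qed

text \<open>After normalisation and a phase rotation of \<open>g\<close>, the inner product is a
  real \<open>c\<close> with \<open>0 < c < 1\<close>. The sum \<open>p\<close> and the difference
  \<open>q\<close> are then orthogonal, and \<open>t\<close> is the ratio of their norms:
  nonorthogonality gives \<open>t < 1\<close>, nonparallelism gives \<open>0 < t\<close>.\<close>

lemma symmetric_pair:
  fixes f g :: "'i \<Rightarrow> complex"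
  assumes fin: "finite I" and nonorth: "inner_on I f g \<noteq> 0" and nonpar: "\<And>c. \<exists>i\<in>I. f i \<noteq> c * g i"
  obtains u v :: "'i \<Rightarrow> complex" and t :: real and a b :: complex
  where "inner_on I u u = 1" "inner_on I v v = 1" "inner_on I u v = 0" "0 < t" "t < 1"
    "f = (\<lambda>i. a * (u i + t * v i))" "g = (\<lambda>i. b * (u i - t * v i))"
proof -
  define nf where "nf = (\<Sum>i\<in>I. (cmod (f i))\<^sup>2)"
  define ng where "ng = (\<Sum>i\<in>I. (cmod (g i))\<^sup>2)"
  define z where "z = inner_on I f g"
  have nf: "inner_on I f f = of_real nf" and ng: "inner_on I g g = of_real ng"
    by (simp_all only: inner_on_self nf_def ng_def)
  have "0 \<le> nf" "0 \<le> ng"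
    by (simp_all add: nf_def ng_def sum_nonneg)
  moreover have "nf \<noteq> 0" "ng \<noteq> 0"
    using nonorth fin by (auto simp: nf_def ng_def inner_on_def sum_nonneg_eq_0_iff intro: ccontr)
  ultimately have pos: "0 < nf" "0 < ng"
    by auto
  have "z \<noteq> 0"
    using nonorth by (simp add: z_def)
  define \<alpha> where "\<alpha> = complex_of_real (1 / sqrt nf)"
  \<comment> \<open>The factor \<open>cnj z / cmod z\<close> cancels the phase of
    \<open>z\<close>.\<close>
  define \<beta> where "\<beta> = cnj z / cmod z * complex_of_real (1 / sqrt ng)"
  define c where "c = cmod z / (sqrt nf * sqrt ng)"
  define p where "p = (\<lambda>i. \<alpha> * f i + \<beta> * g i)"
  define q where "q = (\<lambda>i. \<alpha> * f i - \<beta> * g i)"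
  have nz: "\<alpha> \<noteq> 0" "\<beta> \<noteq> 0"
    using pos \<open>z \<noteq> 0\<close> by (auto simp: \<alpha>_def \<beta>_def)
  have "0 < c"
    using pos \<open>z \<noteq> 0\<close> by (simp add: c_def)
  have zz: "z * cnj z = of_real (cmod z) * of_real (cmod z)"
    by (metis complex_norm_square power2_eq_square of_real_mult)
  have ff: "cnj \<alpha> * (\<alpha> * inner_on I f f) = 1"
    using pos by (simp add: \<alpha>_def nf field_simps flip: of_real_mult)
  have gg: "cnj \<beta> * (\<beta> * inner_on I g g) = 1"
  proof -
    have "cnj \<beta> * \<beta> = 1 / of_real ng"
      using pos \<open>z \<noteq> 0\<close> zz by (simp add: \<beta>_def field_simps flip: of_real_mult)
    then show ?thesis
      using pos by (simp add: ng mult.assoc[symmetric])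
  qed
  have fg: "cnj \<alpha> * (\<beta> * inner_on I f g) = of_real c"
    using pos \<open>z \<noteq> 0\<close> zz by (simp add: \<alpha>_def \<beta>_def c_def z_def[symmetric] field_simps)
  have gf: "cnj \<beta> * (\<alpha> * inner_on I g f) = of_real c"
    using arg_cong[OF fg, of cnj]
    by (simp only: complex_cnj_mult complex_cnj_cnj cnj_inner_on complex_cnj_complex_of_real mult.left_commute)
  note expand = inner_on_add_left inner_on_add_right inner_on_diff_left inner_on_diff_right
    inner_on_scale_left inner_on_scale_right
  have pp: "inner_on I p p = of_real (2 + 2 * c)" and qq: "inner_on I q q = of_real (2 - 2 * c)"
    and pq: "inner_on I p q = 0"
    using ff gg fg gf by (simp_all add: p_def q_def expand algebra_simps)
  \<comment> \<open>At \<open>c = 1\<close> the difference \<open>q\<close> would vanish, making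
    \<open>f\<close> a multiple of \<open>g\<close>.\<close>
  have "c < 1"
  proof -
    obtain i where i: "i \<in> I" "f i \<noteq> \<beta> / \<alpha> * g i"
      using nonpar by blast
    then have "q i \<noteq> 0"
      using nz by (auto simp: q_def field_simps)
    then have "0 < (\<Sum>i\<in>I. (cmod (q i))\<^sup>2)"
      using i fin by (intro sum_pos2[of _ i]) auto
    then show ?thesis
      using qq unfolding inner_on_self of_real_eq_iff by simp
  qed
  define sp where "sp = sqrt (2 + 2 * c)"
  define sq where "sq = sqrt (2 - 2 * c)"
  define t where "t = sq / sp"
  have s: "0 < sp" "0 < sq" "sp * sp = 2 + 2 * c" "sq * sq = 2 - 2 * c" "sq < sp"
    using \<open>0 < c\<close> \<open>c < 1\<close> by (auto simp: sp_def sq_def)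
  show thesis
  proof (rule that)
    let ?u = "\<lambda>i. of_real (1 / sp) * p i" and ?v = "\<lambda>i. of_real (1 / sq) * q i"
    have "inner_on I ?u ?u = of_real (1 / sp * (1 / sp * (sp * sp)))"
      by (simp only: expand pp complex_cnj_complex_of_real of_real_mult s)
    then show "inner_on I ?u ?u = 1"
      using s(1,2) by simp
    have "inner_on I ?v ?v = of_real (1 / sq * (1 / sq * (sq * sq)))"
      by (simp only: expand qq complex_cnj_complex_of_real of_real_mult s)
    then show "inner_on I ?v ?v = 1"
      using s(1,2) by simp
    show "inner_on I ?u ?v = 0"
      by (simp only: expand pq mult_zero_right)
    show "0 < t" "t < 1"
      using s by (auto simp: t_def)
    \<comment> \<open>With this, both identities reduce to \<open>p + q = 2 \<alpha> f\<close> and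
      \<open>p - q = 2 \<beta> g\<close>.\<close>
    have v: "of_real t * ?v i = of_real (1 / sp) * q i" for i
      using s by (simp add: t_def)
    show "f = (\<lambda>i. of_real (sp / 2) / \<alpha> * (?u i + of_real t * ?v i))"
      unfolding v using s nz by (intro ext) (simp add: p_def q_def field_simps)
    show "g = (\<lambda>i. of_real (sp / 2) / \<beta> * (?u i - of_real t * ?v i))"
      unfolding v using s nz by (intro ext) (simp add: p_def q_def field_simps)
  qed
qed

text \<open>This phase closes the polygon of the terms \<open>t\<^bsup>|z|\<^esup> e\<^bsup>i\<theta>|z|\<^esup>\<close>, \<open>z \<in> {0,1}\<^sup>m - {0}\<close>,
  with one further side of length \<open>1\<close>.\<close>

lemma exists_phase:
  fixes t :: real
  assumes t: "0 < t" "t < 1" and m: "2 \<le> (1 + t) ^ m"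
  obtains \<theta> where "cmod ((1 + t * cis \<theta>) ^ m - 1) = 1"
proof -
  let ?f = "\<lambda>\<theta>. cmod ((1 + t * cis \<theta>) ^ m - 1)"
  have "?f pi = cmod (of_real ((1 - t) ^ m - 1))"
    by simp
  also have "\<dots> = \<bar>(1 - t) ^ m - 1\<bar>"
    by (simp only: norm_of_real)
  also have "\<dots> \<le> 1"
    using t power_le_one[of "1 - t" m] zero_le_power[of "1 - t" m] by auto
  finally have "?f pi \<le> 1" .
  moreover have "1 \<le> ?f 0"
  proof -
    have "?f 0 = cmod (of_real ((1 + t) ^ m - 1))"
      by simp
    also have "\<dots> = \<bar>(1 + t) ^ m - 1\<bar>"
      by (simp only: norm_of_real)
    finally show ?thesis
      using m by simp
  qed
  moreover have "continuous_on {0..pi} ?f"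
    unfolding cis_conv_exp by (intro continuous_intros)
  ultimately show thesis
    using IVT2'[of ?f pi 1 0] that by auto
qed


text \<open>The measurement vectors are the Hadamard basis twisted by the phases \<open>ph\<close>. The sign pattern
  \<open>sg b\<close> of the product state indexed by \<open>b\<close> cancels that of the measurement vector with the same
  index, so all these inner products equal the same polygonal sum up to a factor.\<close>

lemma exists_excluding_povm:
  fixes \<psi> :: "'x \<Rightarrow> 'y::finite \<Rightarrow> complex"
  assumes nonorth: "inner_on UNIV (\<psi> x) (\<psi> x') \<noteq> 0" and nonpar: "\<And>c. \<exists>y. \<psi> x y \<noteq> c * \<psi> x' y"
  obtains m r E where "m > 0" "is_povm (tuples m) r E"
    and "\<And>k. k < r \<Longrightarrow> \<exists>xs\<in>tuples m. set xs \<subseteq> {x, x'} \<and> attack_prob m \<psi> r E xs k = 0"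
proof -
  have nonpar': "\<exists>y\<in>UNIV. \<psi> x y \<noteq> c * \<psi> x' y" for c
    using nonpar by simp
  obtain u v :: "'y \<Rightarrow> complex" and t :: real and a b where uv: "inner_on UNIV u u = 1" "inner_on UNIV v v = 1" "inner_on UNIV u v = 0"
    and t: "0 < t" "t < 1" and \<psi>x: "\<psi> x = (\<lambda>y. a * (u y + t * v y))" and \<psi>x': "\<psi> x' = (\<lambda>y. b * (u y - t * v y))"
    by (rule symmetric_pair[OF finite_class.finite_UNIV nonorth nonpar'])
  \<comment> \<open>This many copies let \<open>exists_phase\<close> close the polygon; the bound
    also rules out \<open>m = 0\<close>.\<close>
  obtain m where m: "2 < (1 + t) ^ m"
    using real_arch_pow[of "1 + t" 2] t by auto
  then have "m > 0"
    by (cases m) auto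
  obtain \<theta> where \<theta>: "cmod ((1 + t * cis \<theta>) ^ m - 1) = 1"
    using exists_phase[OF t, of m] m by auto
  \<comment> \<open>\<open>True\<close> marks the component \<open>v\<close>, so \<open>T\<close> is
    the product basis for copies of the span of \<open>u\<close> and \<open>v\<close>.\<close>
  define e where "e = (\<lambda>\<zeta>. if \<zeta> then v else u)"
  define T where "T = (\<lambda>z ys. \<Prod>i<m. e (z ! i) (ys ! i))"
  \<comment> \<open>The Hadamard sign: -1 to the number of positions where both \<open>b\<close> and
    \<open>z\<close> are \<open>True\<close>. Likewise \<open>\<tau> z\<close> is \<open>t\<close>
    to the number of \<open>True\<close> entries of \<open>z\<close>.\<close>
  define sg where "sg = (\<lambda>b z. \<Prod>i<m. if b ! i \<and> z ! i then -1 else 1 :: complex)"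
  define \<tau> where "\<tau> = (\<lambda>z. \<Prod>i<m. if z ! i then complex_of_real t else 1)"
  define z0 where "z0 = replicate m False"
  \<comment> \<open>The value at \<open>z0\<close> is minus the sum of all other terms
    \<open>ph z * \<tau> z\<close>; the choice of \<open>\<theta>\<close> gives it modulus
    1.\<close>
  define ph where "ph = (\<lambda>z. if z = z0 then 1 - (1 + t * cis \<theta>) ^ m else \<Prod>i<m. if z ! i then cis \<theta> else 1)"
  define S where "S = complex_of_real (1 / sqrt (2 ^ m))"
  define h where "h = (\<lambda>b z. S * sg b z * cnj (ph z))"
  define \<Phi> where "\<Phi> = (\<lambda>b. tensor_power m \<psi> (map (\<lambda>\<beta>. if \<beta> then x' else x) b))"
  have z0: "z0 \<in> tuples m"
    by (simp add: z0_def tuples_def)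
  have ne: "\<exists>i<m. z ! i \<noteq> z' ! i" if "z \<noteq> z'" "z \<in> tuples m" "z' \<in> tuples m" for z z' :: "bool list"
    using that by (auto simp: tuples_def list_eq_iff_nth_eq)
  have T: "orthonormal_on (tuples m) (tuples m) T"
    unfolding orthonormal_on_def
  proof (intro ballI)
    fix z z' :: "bool list" assume z: "z \<in> tuples m" "z' \<in> tuples m"
    have "inner_on (tuples m) (T z) (T z') = (\<Sum>ys\<in>tuples m. \<Prod>i<m. cnj (e (z ! i) (ys ! i)) * e (z' ! i) (ys ! i))"
      by (simp add: inner_on_def T_def prod.distrib)
    also have "\<dots> = (\<Prod>i<m. inner_on UNIV (e (z ! i)) (e (z' ! i)))"
      unfolding inner_on_def by (rule sum_tuples_prod)
    also have "\<dots> = (\<Prod>i<m. if z ! i = z' ! i then 1 else 0)"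
      using uv cnj_inner_on[of UNIV u v] by (intro prod.cong) (auto simp: e_def)
    also have "\<dots> = (if z = z' then 1 else 0)"
      using ne[OF _ z] by (auto simp: prod_zero_iff)
    finally show "inner_on (tuples m) (T z) (T z') = (if z = z' then 1 else 0)" .
  qed
  have ph: "ph z * cnj (ph z) = 1" for z
  proof -
    have "cmod (ph z) = 1"
    proof (cases "z = z0")
      case True
      then show ?thesis
        using \<theta> by (simp add: ph_def norm_minus_commute)
    next
      case False
      have "cmod (\<Prod>i<m. if z ! i then cis \<theta> else 1) = 1"
        unfolding prod_norm[symmetric] by (intro prod.neutral) auto
      then show ?thesis
        using False by (simp add: ph_def)
    qed
    then show ?thesis
      by (simp add: complex_norm_square[symmetric] del: of_real_power)
  qed
  \<comment> \<open>Character orthogonality: a position where \<open>z\<close> and \<open>z'\<close>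
    differ contributes a factor 0.\<close>
  have sg: "(\<Sum>b\<in>tuples m. sg b z * sg b z') = (if z = z' then 2 ^ m else 0)"
    if z: "z \<in> tuples m" "z' \<in> tuples m" for z z'
  proof -
    have "(\<Sum>b\<in>tuples m. sg b z * sg b z') =
      (\<Sum>b\<in>tuples m. \<Prod>i<m. (if b ! i \<and> z ! i then -1 else 1) * (if b ! i \<and> z' ! i then -1 else 1))"
      by (simp only: sg_def prod.distrib)
    also have "\<dots> = (\<Prod>i<m. \<Sum>\<beta>\<in>UNIV. (if \<beta> \<and> z ! i then -1 else 1) * (if \<beta> \<and> z' ! i then -1 else 1))"
      by (rule sum_tuples_prod)
    also have "\<dots> = (\<Prod>i<m. if z ! i = z' ! i then 2 else 0)"
      by (intro prod.cong) (auto simp: UNIV_bool)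
    also have "\<dots> = (if z = z' then 2 ^ m else 0)"
      using ne[OF _ z] by (auto simp: prod_zero_iff)
    finally show ?thesis .
  qed
  have h: "(\<Sum>b\<in>tuples m. h b z * cnj (h b z')) = (if z = z' then 1 else 0)"
    if z: "z \<in> tuples m" "z' \<in> tuples m" for z z'
  proof -
    have "cnj (sg b z') = sg b z'" for b
      unfolding sg_def cnj_prod by (intro prod.cong) auto
    then have "h b z * cnj (h b z') = S * cnj S * (cnj (ph z) * ph z') * (sg b z * sg b z')" for b
      by (simp add: h_def mult_ac)
    moreover have "S * cnj S = 1 / 2 ^ m"
      unfolding S_def complex_cnj_complex_of_real of_real_mult[symmetric] by simp
    ultimately have "h b z * cnj (h b z') = 1 / 2 ^ m * (cnj (ph z) * ph z') * (sg b z * sg b z')" for b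
      by simp
    then have "(\<Sum>b\<in>tuples m. h b z * cnj (h b z')) = 1 / 2 ^ m * (cnj (ph z) * ph z') * (if z = z' then 2 ^ m else 0)"
      by (simp only: sum_distrib_left[symmetric] sg[OF z])
    then show ?thesis
      using ph[of z'] by (simp add: mult.commute)
  qed
  obtain r E where E: "is_povm (tuples m) r E"
    and cases: "\<And>k. k < r \<Longrightarrow>
      (\<exists>b\<in>tuples m. E k = (\<lambda>i j. (\<Sum>z\<in>tuples m. h b z * T z i) * cnj (\<Sum>z\<in>tuples m. h b z * T z j))) \<or>
      E k = (\<lambda>i j. (if i = j then 1 else 0) - (\<Sum>z\<in>tuples m. T z i * cnj (T z j)))"
    using povm_from_orthonormal[OF finite_tuples finite_tuples finite_tuples T h] by blast
  \<comment> \<open>Each factor \<open>u + t v\<close> or \<open>u - t v\<close> is expanded;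
    \<open>C\<close> collects the prefactors \<open>a\<close> and \<open>b\<close>.\<close>
  have \<Phi>: "\<exists>C. \<forall>ys\<in>tuples m. \<Phi> bs ys = (\<Sum>z\<in>tuples m. (C * sg bs z * \<tau> z) * T z ys)"
    if bs: "bs \<in> tuples m" for bs
  proof (intro exI ballI)
    fix ys :: "'y list" assume ys: "ys \<in> tuples m"
    let ?s = "\<lambda>\<beta>. if \<beta> then b else a"
    let ?q = "\<lambda>i \<zeta>. (if bs ! i \<and> \<zeta> then -1 else 1) * (if \<zeta> then complex_of_real t else 1) * e \<zeta> (ys ! i)"
    have "\<Phi> bs ys = (\<Prod>i<m. ?s (bs ! i) * (\<Sum>\<zeta>\<in>UNIV. ?q i \<zeta>))"
      unfolding \<Phi>_def tensor_power_def
      using bs by (intro prod.cong refl) (auto simp: tuples_def \<psi>x \<psi>x' UNIV_bool e_def algebra_simps)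
    also have "\<dots> = (\<Prod>i<m. ?s (bs ! i)) * (\<Sum>z\<in>tuples m. \<Prod>i<m. ?q i (z ! i))"
      unfolding sum_tuples_prod[where f = ?q] by (rule prod.distrib)
    also have "\<dots> = (\<Sum>z\<in>tuples m. ((\<Prod>i<m. ?s (bs ! i)) * sg bs z * \<tau> z) * T z ys)"
      by (simp only: sum_distrib_left prod.distrib sg_def \<tau>_def T_def mult.assoc)
    finally show "\<Phi> bs ys = (\<Sum>z\<in>tuples m. ((\<Prod>i<m. ?s (bs ! i)) * sg bs z * \<tau> z) * T z ys)" .
  qed
  have polygon: "(\<Sum>z\<in>tuples m. ph z * \<tau> z) = 0"
  proof -
    have \<tau>0: "\<tau> z0 = 1"
      by (simp add: \<tau>_def z0_def)
    have "(\<Sum>z\<in>tuples m. (\<Prod>i<m. if z ! i then cis \<theta> else 1) * \<tau> z) =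
      (\<Sum>z\<in>tuples m. \<Prod>i<m. if z ! i then t * cis \<theta> else 1)"
      unfolding \<tau>_def prod.distrib[symmetric] by (intro sum.cong prod.cong) auto
    also have "\<dots> = (\<Prod>i<m. \<Sum>\<zeta>\<in>UNIV. if \<zeta> then t * cis \<theta> else 1)"
      by (rule sum_tuples_prod)
    also have "\<dots> = (1 + t * cis \<theta>) ^ m"
      by (simp add: UNIV_bool)
    finally have "(\<Sum>z\<in>tuples m - {z0}. (\<Prod>i<m. if z ! i then cis \<theta> else 1) * \<tau> z) = (1 + t * cis \<theta>) ^ m - 1"
      using z0 by (simp add: sum_diff1 \<tau>0) (simp add: z0_def)
    then show ?thesis
      using z0 by (simp add: sum.remove[of _ z0] ph_def \<tau>0)
  qed
  have zero: "attack_prob m \<psi> r E (map (\<lambda>\<beta>. if \<beta> then x' else x) bs) k = 0"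
    if "k < r" and bs: "bs \<in> tuples m" and
      "E k = (\<lambda>i j. (\<Sum>z\<in>tuples m. h bs z * T z i) * cnj (\<Sum>z\<in>tuples m. h bs z * T z j)) \<or>
      E k = (\<lambda>i j. (if i = j then 1 else 0) - (\<Sum>z\<in>tuples m. T z i * cnj (T z j)))" for bs k
  proof -
    obtain C where C: "\<And>ys. ys \<in> tuples m \<Longrightarrow> \<Phi> bs ys = (\<Sum>z\<in>tuples m. (C * sg bs z * \<tau> z) * T z ys)"
      using \<Phi>[OF bs] by blast
    let ?\<Xi> = "\<lambda>i. \<Sum>z\<in>tuples m. h bs z * T z i"
    have "(\<Sum>ys\<in>tuples m. \<Sum>ys'\<in>tuples m. cnj (\<Phi> bs ys) * E k ys ys' * \<Phi> bs ys') = 0"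
      using that(3)
    proof
      assume Ek: "E k = (\<lambda>i j. ?\<Xi> i * cnj (?\<Xi> j))"
      have "inner_on (tuples m) (T z) (\<Phi> bs) = C * sg bs z * \<tau> z" if z: "z \<in> tuples m" for z
      proof -
        have "inner_on (tuples m) (T z) (\<Phi> bs) =
          inner_on (tuples m) (T z) (\<lambda>ys. \<Sum>z\<in>tuples m. (C * sg bs z * \<tau> z) * T z ys)"
          unfolding inner_on_def by (intro sum.cong refl) (simp add: C)
        also have "\<dots> = (\<Sum>z'\<in>tuples m. if z = z' then C * sg bs z' * \<tau> z' else 0)"
          unfolding inner_on_sum_right using T z by (intro sum.cong refl) (simp add: orthonormal_on_def)
        finally show ?thesis
          using z by simp
      qed
      then have "inner_on (tuples m) ?\<Xi> (\<Phi> bs) = (\<Sum>z\<in>tuples m. cnj (h bs z) * (C * sg bs z * \<tau> z))"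
        unfolding inner_on_sum_left by simp
      also have "\<dots> = (\<Sum>z\<in>tuples m. cnj S * C * (ph z * \<tau> z))"
      proof (intro sum.cong refl)
        fix z :: "bool list"
        have "cnj (sg bs z) * sg bs z = 1"
          unfolding sg_def cnj_prod prod.distrib[symmetric] by (intro prod.neutral) auto
        moreover have "cnj (h bs z) * (C * sg bs z * \<tau> z) =
          cnj S * C * (ph z * \<tau> z) * (cnj (sg bs z) * sg bs z)"
          by (simp add: h_def mult_ac)
        ultimately show "cnj (h bs z) * (C * sg bs z * \<tau> z) = cnj S * C * (ph z * \<tau> z)"
          by simp
      qed
      also have "\<dots> = 0"
        by (simp only: sum_distrib_left[symmetric] polygon mult_zero_right)
      finally show ?thesis
        unfolding Ek rank_one_form by simp
    next
      assume Ek: "E k = (\<lambda>i j. (if i = j then 1 else 0) - (\<Sum>z\<in>tuples m. T z i * cnj (T z j)))"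
      \<comment> \<open>Every \<open>\<Phi> bs\<close> lies in the span of \<open>T\<close>, so this
        outcome is excluded for each string.\<close>
      show ?thesis
        unfolding Ek by (rule complement_form_span[OF finite_tuples finite_tuples T C])
    qed
    then show ?thesis
      using \<open>k < r\<close> by (simp add: attack_prob_def \<Phi>_def)
  qed
  have "\<exists>xs\<in>tuples m. set xs \<subseteq> {x, x'} \<and> attack_prob m \<psi> r E xs k = 0" if k: "k < r" for k
  proof -
    \<comment> \<open>For the complementary outcome, \<open>z0\<close> serves as \<open>bs\<close>;
      its string consists of \<open>x\<close> only.\<close>
    obtain bs where bs: "bs \<in> tuples m" "attack_prob m \<psi> r E (map (\<lambda>\<beta>. if \<beta> then x' else x) bs) k = 0"
      using cases[OF k] zero[OF k] z0 by blast
    then show ?thesis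
      by (intro bexI[of _ "map (\<lambda>\<beta>. if \<beta> then x' else x) bs"]) (auto simp: tuples_def)
  qed
  with \<open>m > 0\<close> E show thesis
    by (rule that)
qed

section \<open>Composability implies triviality\<close>

theorem theorem8p1:
  fixes P :: "('x::finite \<times> 'y::finite) pmf"
    and \<psi> :: "'x \<Rightarrow> 'y \<Rightarrow> complex"
  assumes "regular_embedding P \<psi>"
    and "weakly_self_composable \<psi>"
  shows "trivial_embedding P \<psi>"
proof (rule ccontr)
  assume "\<not> trivial_embedding P \<psi>"
  then have "dependent_entropy P \<psi> \<noteq> 0"
    by (simp add: trivial_embedding_def)
  then obtain x x' where x: "x \<in> set_pmf (map_pmf fst P)" "x' \<in> set_pmf (map_pmf fst P)"
    and diff: "dependent_part P x \<noteq> dependent_part P x'"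
    and nonorth: "inner_on UNIV (\<psi> x) (\<psi> x') \<noteq> 0"
    using dependent_entropy_eq_0[OF assms(1)] unfolding inner_on_def by blast
  have nonpar: "\<exists>y. \<psi> x y \<noteq> c * \<psi> x' y" for c
    using dependent_part_eq_if_parallel[OF assms(1) _ x] diff by blast
  obtain m r E where "m > 0" and povm: "is_povm (tuples m) r E"
    and excl: "\<And>k. k < r \<Longrightarrow> \<exists>xs\<in>tuples m. set xs \<subseteq> {x, x'} \<and> attack_prob m \<psi> r E xs k = 0"
    using exists_excluding_povm[of \<psi> x x', OF nonorth nonpar] by blast
  obtain FB \<sigma> where "is_interface FB" "is_simulator m \<sigma>" "simulates m \<psi> FB \<sigma> r E"
    using assms(2) \<open>m > 0\<close> povm unfolding weakly_self_composable_def all_attacks_simulated_def by meson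
  then show False
    using excluding_attack_not_simulated[OF _ _ povm excl nonorth[unfolded inner_on_def]] by blast
qed

end
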